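(* Let $G$ be a finitely generated abelian group and let $d$ be the rank of $G$. Then no topological dynamical system $(X,T,G)$ has $2(d+1)$-fold strong topological minimal self-joinings.
   Context: A topological dynamical system $(X,T,G)$ is a compact metric space $X$ with a continuous action $T$ of $G$, written $T^g\colon X\to X$, with $T^{1_G}=\mathrm{id}_X$ and $T^{g}\circ T^{g'}=T^{gg'}$. $Z(G)$ denotes the center of $G$ (here $Z(G)=G$). For $n\ge 1$, $(X,T,G)$ has $n$-fold strong topological minimal self-joinings ($n$-fold sTMSJ) if $X$ is infinite and for every $1\le k\le n$ and every $k$ distinct points $x_1,\dots,x_k\in X$ all lying in different $Z(G)$-orbits, the orbit $\{(T^gx_1,\dots,T^gx_k): g\in G\}$ is dense in $X^k$. In particular such a system is minimal. The rank of $G$ is the dimension of $\mathbb{Q}\otimes G$ over $\mathbb{Q}$. *)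

theory Defs
  imports
    "HOL-Analysis.Analysis"
    "HOL-Algebra.Free_Abelian_Groups"
    "Jordan_Normal_Form.VS_Connect"
begin

definition finitely_generated :: "('g, 'm) monoid_scheme \<Rightarrow> bool" where
  "finitely_generated G \<longleftrightarrow>
     (\<exists>S. finite S \<and> S \<subseteq> carrier G \<and> generate G S = carrier G)"

definition group_center :: "('g, 'm) monoid_scheme \<Rightarrow> 'g set" where
  "group_center G =
     {z \<in> carrier G. \<forall>g \<in> carrier G. z \<otimes>\<^bsub>G\<^esub> g = g \<otimes>\<^bsub>G\<^esub> z}"

(* The tensor product of the integer modules \<rat> and G, as the free abelian group on \<rat> \<times> G
   modulo the bilinearity relations. G is written multiplicatively. *)

abbreviation tensor_free :: "('g, 'm) monoid_scheme \<Rightarrow> ((rat \<times> 'g) \<Rightarrow>\<^sub>0 int) monoid" where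
  "tensor_free G \<equiv> free_Abelian_group (UNIV \<times> carrier G)"

definition tensor_relations :: "('g, 'm) monoid_scheme \<Rightarrow> ((rat \<times> 'g) \<Rightarrow>\<^sub>0 int) set" where
  "tensor_relations G = generate (tensor_free G)
     ({frag_of (a + b, g) - frag_of (a, g) - frag_of (b, g) | a b g. g \<in> carrier G} \<union>
      {frag_of (a, g \<otimes>\<^bsub>G\<^esub> h) - frag_of (a, g) - frag_of (a, h) | a g h.
         g \<in> carrier G \<and> h \<in> carrier G})"

definition tensor_scale :: "rat \<Rightarrow> ((rat \<times> 'g) \<Rightarrow>\<^sub>0 int) \<Rightarrow> ((rat \<times> 'g) \<Rightarrow>\<^sub>0 int)" where
  "tensor_scale q = frag_extend (\<lambda>(a, g). frag_of (q * a, g))"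

(* Elements are cosets of the relations; the scalar q sends the coset of c to the coset of
   tensor_scale q c. The ring fields mult and one of the module record play no role. *)
definition rat_tensor :: "('g, 'm) monoid_scheme \<Rightarrow> (rat, ((rat \<times> 'g) \<Rightarrow>\<^sub>0 int) set) module" where
  "rat_tensor G =
     \<lparr>carrier = carrier (tensor_free G Mod tensor_relations G),
      mult = undefined,
      one = undefined,
      zero = \<one>\<^bsub>tensor_free G Mod tensor_relations G\<^esub>,
      add = (\<otimes>\<^bsub>tensor_free G Mod tensor_relations G\<^esub>),
      smult = (\<lambda>q C. tensor_relations G <#>\<^bsub>tensor_free G\<^esub> (tensor_scale q ` C))\<rparr>"

definition group_rank :: "('g, 'm) monoid_scheme \<Rightarrow> nat" where
  "group_rank G = vectorspace.dim (class_ring :: rat ring) (rat_tensor G)"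

(* The acting group carries the discrete topology, so that continuity of the action means
   continuity of each T g. *)
locale topological_dynamical_system = group G
  for G :: "('g, 'm) monoid_scheme" (structure) and
      X :: "'x::metric_space set" and T :: "'g \<Rightarrow> 'x \<Rightarrow> 'x" +
  assumes compact_space: "compact X"
    and maps_to: "g \<in> carrier G \<Longrightarrow> T g \<in> X \<rightarrow> X"
    and continuous: "g \<in> carrier G \<Longrightarrow> continuous_on X (T g)"
    and act_one: "x \<in> X \<Longrightarrow> T \<one> x = x"
    and act_mult: "\<lbrakk>g \<in> carrier G; h \<in> carrier G; x \<in> X\<rbrakk> \<Longrightarrow> T g (T h x) = T (g \<otimes> h) x"

definition strong_TMSJ ::
  "nat \<Rightarrow> ('g, 'm) monoid_scheme \<Rightarrow> 'x::topological_space set \<Rightarrow> ('g \<Rightarrow> 'x \<Rightarrow> 'x) \<Rightarrow> bool" where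
  "strong_TMSJ n G X T \<longleftrightarrow>
     infinite X \<and>
     (\<forall>k x. 1 \<le> k \<and> k \<le> n \<and> x \<in> {..<k} \<rightarrow> X \<and> inj_on x {..<k} \<and>
        (\<forall>i<k. \<forall>j<k. i \<noteq> j \<longrightarrow>
           (\<lambda>z. T z (x i)) ` group_center G \<noteq> (\<lambda>z. T z (x j)) ` group_center G) \<longrightarrow>
        Abstract_Topology.closure_of (product_topology (\<lambda>_. top_of_set X) {..<k})
          ((\<lambda>g. \<lambda>i\<in>{..<k}. T g (x i)) ` carrier G) = {..<k} \<rightarrow>\<^sub>E X)"

end

theory Submission
  imports Defs
begin

text \<open>
  Modulo torsion, \<open>G\<close> is a lattice in \<open>\<real>\<^sup>d\<close>. Fix a small \<open>e\<close> and call a time \<open>g\<close> good for a pair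
  of points if \<open>T g\<close> moves them to distance at most \<open>e\<close>. For every direction \<open>u\<close> there is a pair of
  distinct points for which all times in some half-space \<open>{g. v \<bullet> g > 0}\<close> with \<open>v \<bullet> u \<ge> 0\<close> are good:
  move a large ball of good times in direction \<open>- u\<close>, letting it grow slowly, until it touches a bad
  time, and pass to a limit. (If no bad time were ever met, elements of \<open>G\<close> far out in direction
  \<open>- u\<close> would contract balls of a fixed radius to arbitrarily small sets, which is impossible on an
  infinite compact space.) Hence \<open>0\<close> lies in the convex hull of the normals \<open>v\<close> that occur, and by
  Caratheodory's theorem \<open>d + 1\<close> of the closed half-spaces already cover the lattice. This gives
  \<open>d + 1\<close> pairs such that every time is good for at least one of them, which contradicts the density
  of the joint orbit of these \<open>2 * (d + 1)\<close> points.
\<close>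

section \<open>The rank\<close>

text \<open>Density of the joint orbit cannot be used directly: the two points of a pair might lie
  in one orbit, and points of different pairs might share an orbit, whereas
  \<open>strong_TMSJ\<close> speaks of different orbits. Against the first, \<open>e\<close> is so
  small that a group element moving no point by more than \<open>e\<close> acts trivially; two
  distinct points of one orbit that are \<open>e\<close>-close on a half-space would give such an
  element acting nontrivially. Against the second, all points are written as translates of orbit
  representatives, and targets are chosen for the representatives only; fixed group elements whose
  images of any point are more than \<open>2 * e\<close> apart leave enough room for this choice.

  The growth rate \<open>c\<close> of the moving balls must be positive, so that deep balls contain
  translates of every finite set, and below 1, so that growth stays slower than motion. It costs an
  error \<open>- c\<close> in the sign of the inner product of \<open>v\<close> and
  \<open>u\<close>, so zero is first only an approximate convex combination of normals; it becomes
  exact in the limit of infinite radius. The closed half-spaces come from the open ones by shifting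
  each pair. The rank enters through \<open>card B \<le> d\<close>, where \<open>B\<close> is a
  maximal independent set of generators.\<close>

definition tensor_coset :: "('g, 'm) monoid_scheme \<Rightarrow> ((rat \<times> 'g) \<Rightarrow>\<^sub>0 int) \<Rightarrow> ((rat \<times> 'g) \<Rightarrow>\<^sub>0 int) set" where
  "tensor_coset G c = tensor_relations G #>\<^bsub>tensor_free G\<^esub> c"

context comm_group
begin

abbreviation frags :: "((rat \<times> 'a) \<Rightarrow>\<^sub>0 int) set" where
  "frags \<equiv> carrier (tensor_free G)"

lemma frags_add: "c \<in> frags \<Longrightarrow> c' \<in> frags \<Longrightarrow> c + c' \<in> frags"
  and frags_diff: "c \<in> frags \<Longrightarrow> c' \<in> frags \<Longrightarrow> c - c' \<in> frags"
  and frags_minus: "c \<in> frags \<Longrightarrow> - c \<in> frags"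
  and frags_zero: "0 \<in> frags"
  and frags_of: "g \<in> carrier G \<Longrightarrow> frag_of (a, g) \<in> frags"
  using keys_add[of c c'] keys_diff[of c c'] by auto

lemma frags_inv: "c \<in> frags \<Longrightarrow> inv\<^bsub>tensor_free G\<^esub> c = - c"
  by simp

lemma frags_induct [consumes 1, case_names zero diff of]:
  assumes "c \<in> frags" "P 0"
    and "\<And>c c'. c \<in> frags \<Longrightarrow> c' \<in> frags \<Longrightarrow> P c \<Longrightarrow> P c' \<Longrightarrow> P (c - c')"
    and "\<And>a g. g \<in> carrier G \<Longrightarrow> P (frag_of (a, g))"
  shows "P c"
  by (rule free_Abelian_group_induct[of c "UNIV \<times> carrier G" P])
    (use assms in \<open>auto simp: carrier_free_Abelian_group_iff\<close>)

declare carrier_free_Abelian_group_iff [simp del] frags_zero [simp]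

section \<open>Bilinearity relations and the scalar action on formal sums\<close>

abbreviation tensor_gens :: "((rat \<times> 'a) \<Rightarrow>\<^sub>0 int) set" where
  "tensor_gens \<equiv>
     {frag_of (a + b, g) - frag_of (a, g) - frag_of (b, g) | a b g. g \<in> carrier G} \<union>
     {frag_of (a, g \<otimes> h) - frag_of (a, g) - frag_of (a, h) | a g h.
         g \<in> carrier G \<and> h \<in> carrier G}"

lemma tensor_gens_cases:
  assumes "c \<in> tensor_gens"
  obtains (left) a b g where "g \<in> carrier G" "c = frag_of (a + b, g) - frag_of (a, g) - frag_of (b, g)"
  | (right) a g h where "g \<in> carrier G" "h \<in> carrier G"
      "c = frag_of (a, g \<otimes> h) - frag_of (a, g) - frag_of (a, h)"
  using assms by blast

lemma tensor_relations_gen_subset: "tensor_gens \<subseteq> frags"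
  by (rule subsetI, erule tensor_gens_cases; hypsubst) (intro frags_diff frags_of; simp)+

lemma tensor_relations_subgroup: "subgroup (tensor_relations G) (tensor_free G)"
  unfolding tensor_relations_def
  by (rule group.generate_is_subgroup[OF group_free_Abelian_group tensor_relations_gen_subset])

lemma tensor_relations_normal: "tensor_relations G \<lhd> tensor_free G"
  by (rule comm_group.subgroup_imp_normal[OF abelian_free_Abelian_group tensor_relations_subgroup])

lemma tensor_relations_frags: "r \<in> tensor_relations G \<Longrightarrow> r \<in> frags"
  using subgroup.subset[OF tensor_relations_subgroup] by blast

lemma tensor_relations_zero: "0 \<in> tensor_relations G"
  and tensor_relations_add:
    "r \<in> tensor_relations G \<Longrightarrow> r' \<in> tensor_relations G \<Longrightarrow> r + r' \<in> tensor_relations G"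
  and tensor_relations_minus: "r \<in> tensor_relations G \<Longrightarrow> - r \<in> tensor_relations G"
  using subgroup.one_closed[OF tensor_relations_subgroup]
    subgroup.m_closed[OF tensor_relations_subgroup, of r r']
    subgroup.m_inv_closed[OF tensor_relations_subgroup, of r] tensor_relations_frags[of r]
  by (simp_all add: frags_inv)

lemma tensor_relations_diff:
  "r \<in> tensor_relations G \<Longrightarrow> r' \<in> tensor_relations G \<Longrightarrow> r - r' \<in> tensor_relations G"
  using tensor_relations_add[of r "- r'"] tensor_relations_minus[of r'] by simp

lemma tensor_relation_left:
  "g \<in> carrier G \<Longrightarrow> frag_of (a + b, g) - frag_of (a, g) - frag_of (b, g) \<in> tensor_relations G"
  unfolding tensor_relations_def by (rule generate.incl) blast

lemma tensor_relation_right: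
  "g \<in> carrier G \<Longrightarrow> h \<in> carrier G \<Longrightarrow>
     frag_of (a, g \<otimes> h) - frag_of (a, g) - frag_of (a, h) \<in> tensor_relations G"
  unfolding tensor_relations_def by (rule generate.incl) blast

text \<open>Additivity reduces the claim to the generators; this is the test for a map on formal
  sums to descend to the tensor product.\<close>

lemma additive_zero_on_tensor_relations:
  assumes add: "\<And>c c'. c \<in> frags \<Longrightarrow> c' \<in> frags \<Longrightarrow> \<phi> (c + c') = \<phi> c + (\<phi> c' :: rat)"
    and left: "\<And>a b g. g \<in> carrier G \<Longrightarrow>
      \<phi> (frag_of (a + b, g) - frag_of (a, g) - frag_of (b, g)) = 0"
    and right: "\<And>a g h. g \<in> carrier G \<Longrightarrow> h \<in> carrier G \<Longrightarrow>
      \<phi> (frag_of (a, g \<otimes> h) - frag_of (a, g) - frag_of (a, h)) = 0"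
    and r: "r \<in> tensor_relations G"
  shows "\<phi> r = 0"
proof -
  have 0: "\<phi> 0 = 0"
    using add[of 0 0] by simp
  have neg: "\<phi> (- c) = - \<phi> c" if "c \<in> frags" for c
    using add[of c "- c"] that frags_minus[OF that] 0 by simp
  have "r \<in> frags \<and> \<phi> r = 0"
    using r unfolding tensor_relations_def
  proof (induction rule: generate.induct)
    case one
    then show ?case using 0 by simp
  next
    case (incl h)
    then have "h \<in> frags" by (rule subsetD[OF tensor_relations_gen_subset])
    moreover have "\<phi> h = 0"
      using incl by (cases rule: tensor_gens_cases) (simp_all only: left right)
    ultimately show ?case by (rule conjI)
  next
    case (inv h)
    then have h: "h \<in> frags" by (rule subsetD[OF tensor_relations_gen_subset])
    then have "inv\<^bsub>tensor_free G\<^esub> h = - h" by (rule frags_inv)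
    moreover have "\<phi> h = 0"
      using inv by (cases rule: tensor_gens_cases) (simp_all only: left right)
    ultimately show ?case using neg[OF h] frags_minus[OF h] by simp
  next
    case (eng h1 h2)
    then show ?case using add[of h1 h2] frags_add[of h1 h2] by simp
  qed
  then show ?thesis ..
qed

lemma tensor_scale_of: "tensor_scale q (frag_of (a, g)) = frag_of (q * a, g)"
  unfolding tensor_scale_def by simp

lemma tensor_scale_add: "tensor_scale q (c + c') = tensor_scale q c + tensor_scale q c'"
  and tensor_scale_diff: "tensor_scale q (c - c') = tensor_scale q c - tensor_scale q c'"
  and tensor_scale_zero: "tensor_scale q 0 = 0"
  and tensor_scale_minus: "tensor_scale q (- c) = - tensor_scale q c"
  unfolding tensor_scale_def by (simp_all add: frag_extend_add frag_extend_diff frag_extend_minus)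

lemma tensor_scale_scale:
  "c \<in> frags \<Longrightarrow> tensor_scale q (tensor_scale q' c) = tensor_scale (q * q') c"
  by (induction c rule: frags_induct)
    (simp_all add: tensor_scale_diff tensor_scale_zero tensor_scale_of mult.assoc)

lemma tensor_scale_one: "c \<in> frags \<Longrightarrow> tensor_scale 1 c = c"
  by (induction c rule: frags_induct)
    (simp_all add: tensor_scale_diff tensor_scale_zero tensor_scale_of)

lemma tensor_scale_frags: "c \<in> frags \<Longrightarrow> tensor_scale q c \<in> frags"
  by (induction c rule: frags_induct)
    (simp_all add: tensor_scale_diff tensor_scale_zero tensor_scale_of frags_diff frags_of frags_zero)

text \<open>Distributivity in the rational slot carries each bilinearity generator to a generator,
  so the scalar action is well defined on cosets.\<close>

lemma tensor_scale_relations: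
  assumes "r \<in> tensor_relations G" shows "tensor_scale q r \<in> tensor_relations G"
proof -
  have "r \<in> frags \<and> tensor_scale q r \<in> tensor_relations G"
    using assms unfolding tensor_relations_def[of G]
  proof (induction rule: generate.induct)
    case one
    then show ?case unfolding tensor_relations_def[symmetric]
      using tensor_relations_zero by (simp add: tensor_scale_zero)
  next
    case (incl h)
    then have h: "h \<in> frags" by (rule subsetD[OF tensor_relations_gen_subset])
    have "tensor_scale q h \<in> tensor_relations G"
      using incl tensor_relation_left tensor_relation_right
      by (cases rule: tensor_gens_cases)
        (simp_all add: tensor_scale_diff tensor_scale_of distrib_left)
    then show ?case unfolding tensor_relations_def[symmetric] using h by simp
  next
    case (inv h)
    then have h: "h \<in> frags" by (rule subsetD[OF tensor_relations_gen_subset])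
    then have i: "inv\<^bsub>tensor_free G\<^esub> h = - h" by (rule frags_inv)
    have "tensor_scale q h \<in> tensor_relations G"
      using inv tensor_relation_left tensor_relation_right
      by (cases rule: tensor_gens_cases)
        (simp_all add: tensor_scale_diff tensor_scale_of distrib_left)
    then show ?case unfolding tensor_relations_def[symmetric]
      using h i frags_minus[OF h] tensor_relations_minus by (simp add: tensor_scale_minus)
  next
    case (eng h1 h2)
    then show ?case unfolding tensor_relations_def[symmetric]
      using frags_add[of h1 h2] tensor_relations_add by (simp add: tensor_scale_add)
  qed
  then show ?thesis ..
qed

text \<open>Symbols with different rational entries are formally independent, so this axiom of a
  vector space, unlike the others, holds only modulo the relations.\<close>

lemma tensor_scale_distrib:
  "c \<in> frags \<Longrightarrow>
     tensor_scale (q + q') c - tensor_scale q c - tensor_scale q' c \<in> tensor_relations G"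
proof (induction c rule: frags_induct)
  case zero
  then show ?case by (simp add: tensor_scale_zero tensor_relations_zero)
next
  case (diff x y)
  from tensor_relations_diff[OF diff(3,4)] show ?case
    by (simp add: tensor_scale_diff algebra_simps)
next
  case (of a g)
  then show ?case by (simp add: tensor_scale_of distrib_right tensor_relation_left)
qed

section \<open>The tensor product as a finite-dimensional rational vector space\<close>

lemma tensor_coset_eq: "tensor_coset G c = {r + c | r. r \<in> tensor_relations G}"
  unfolding tensor_coset_def r_coset_def by auto

lemma tensor_coset_eq_iff: "tensor_coset G c = tensor_coset G c' \<longleftrightarrow> c - c' \<in> tensor_relations G"
proof
  assume "tensor_coset G c = tensor_coset G c'"
  moreover have "c \<in> tensor_coset G c" unfolding tensor_coset_eq using tensor_relations_zero by force
  ultimately show "c - c' \<in> tensor_relations G" unfolding tensor_coset_eq by auto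
next
  assume d: "c - c' \<in> tensor_relations G"
  have "r + c \<in> tensor_coset G c'" if "r \<in> tensor_relations G" for r
    using tensor_relations_add[OF that d] unfolding tensor_coset_eq
    by (auto intro!: exI[of _ "r + (c - c')"])
  moreover have "r + c' \<in> tensor_coset G c" if "r \<in> tensor_relations G" for r
    using tensor_relations_diff[OF that d] unfolding tensor_coset_eq
    by (auto intro!: exI[of _ "r - (c - c')"])
  ultimately show "tensor_coset G c = tensor_coset G c'"
    unfolding tensor_coset_eq by auto
qed

lemma rat_tensor_carrier: "carrier (rat_tensor G) = tensor_coset G ` frags"
  unfolding rat_tensor_def FactGroup_def RCOSETS_def tensor_coset_def by auto

lemma rat_tensor_zero: "\<zero>\<^bsub>rat_tensor G\<^esub> = tensor_coset G 0"
  unfolding rat_tensor_def FactGroup_def tensor_coset_eq by auto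

lemma rat_tensor_add:
  assumes "c \<in> frags" "c' \<in> frags"
  shows "tensor_coset G c \<oplus>\<^bsub>rat_tensor G\<^esub> tensor_coset G c' = tensor_coset G (c + c')"
  using normal.rcos_sum[OF tensor_relations_normal assms]
  unfolding rat_tensor_def tensor_coset_def by (simp add: FactGroup_def)

lemma rat_tensor_smult:
  assumes "c \<in> frags"
  shows "q \<odot>\<^bsub>rat_tensor G\<^esub> tensor_coset G c = tensor_coset G (tensor_scale q c)"
proof -
  have "q \<odot>\<^bsub>rat_tensor G\<^esub> tensor_coset G c =
      {r + tensor_scale q (r' + c) | r r'. r \<in> tensor_relations G \<and> r' \<in> tensor_relations G}"
    unfolding rat_tensor_def tensor_coset_eq set_mult_def by auto
  also have "\<dots> = {r + tensor_scale q c | r. r \<in> tensor_relations G}" (is "?L = ?R")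
  proof
    show "?L \<subseteq> ?R"
    proof
      fix x assume "x \<in> ?L"
      then obtain r r' where r: "r \<in> tensor_relations G" "r' \<in> tensor_relations G"
        and x: "x = r + tensor_scale q (r' + c)" by blast
      have "x = (r + tensor_scale q r') + tensor_scale q c"
        by (simp add: x tensor_scale_add add.assoc)
      moreover have "r + tensor_scale q r' \<in> tensor_relations G"
        by (intro tensor_relations_add tensor_scale_relations r)
      ultimately show "x \<in> ?R" by blast
    qed
    show "?R \<subseteq> ?L"
    proof
      fix x assume "x \<in> ?R"
      then obtain r where "r \<in> tensor_relations G" "x = r + tensor_scale q (0 + c)" by auto
      then show "x \<in> ?L" using tensor_relations_zero by blast
    qed
  qed
  finally show ?thesis unfolding tensor_coset_eq .
qed

lemma field_class_ring_rat: "field (class_ring :: rat ring)"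
  using class_field.field_axioms by simp

lemma vectorspace_rat_tensor: "vectorspace (class_ring :: rat ring) (rat_tensor G)"
proof (rule vs_criteria[OF field_class_ring_rat])
  let ?V = "rat_tensor G"
  note simps = rat_tensor_carrier rat_tensor_zero rat_tensor_add rat_tensor_smult
    frags_add frags_minus tensor_scale_frags
  have Z: "0 \<in> frags" by (rule frags_zero)
  have distrib: "tensor_coset G (tensor_scale (a + b) c) =
      tensor_coset G (tensor_scale a c + tensor_scale b c)" if "c \<in> frags" for a b c
    using tensor_scale_distrib[OF that] by (simp only: tensor_coset_eq_iff diff_diff_add)
  show "\<zero>\<^bsub>?V\<^esub> \<in> carrier ?V" using Z by (simp add: simps)
  show "\<forall>v w. v \<in> carrier ?V \<and> w \<in> carrier ?V \<longrightarrow> v \<oplus>\<^bsub>?V\<^esub> w \<in> carrier ?V"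
    by (auto simp: simps)
  show "\<forall>v\<in>carrier ?V. \<exists>w\<in>carrier ?V. v \<oplus>\<^bsub>?V\<^esub> w = \<zero>\<^bsub>?V\<^esub>"
  proof
    fix v assume "v \<in> carrier ?V"
    then obtain c where c: "c \<in> frags" "v = tensor_coset G c" by (auto simp: simps)
    then show "\<exists>w\<in>carrier ?V. v \<oplus>\<^bsub>?V\<^esub> w = \<zero>\<^bsub>?V\<^esub>"
      by (intro bexI[of _ "tensor_coset G (- c)"]) (auto simp: simps)
  qed
  show "\<forall>q v. q \<in> carrier (class_ring :: rat ring) \<and> v \<in> carrier ?V \<longrightarrow> q \<odot>\<^bsub>?V\<^esub> v \<in> carrier ?V"
    by (auto simp: simps)
  show "\<forall>v w. v \<in> carrier ?V \<and> w \<in> carrier ?V \<longrightarrow> v \<oplus>\<^bsub>?V\<^esub> w = w \<oplus>\<^bsub>?V\<^esub> v"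
    by (auto simp: simps add.commute)
  show "\<forall>v w x. v \<in> carrier ?V \<and> w \<in> carrier ?V \<and> x \<in> carrier ?V \<longrightarrow>
      v \<oplus>\<^bsub>?V\<^esub> w \<oplus>\<^bsub>?V\<^esub> x = v \<oplus>\<^bsub>?V\<^esub> (w \<oplus>\<^bsub>?V\<^esub> x)"
    by (auto simp: simps add.assoc)
  show "\<forall>v\<in>carrier ?V. v \<oplus>\<^bsub>?V\<^esub> \<zero>\<^bsub>?V\<^esub> = v"
    using Z by (auto simp: simps)
  show "\<forall>a b v. a \<in> carrier (class_ring :: rat ring) \<and> b \<in> carrier (class_ring :: rat ring) \<and>
      v \<in> carrier ?V \<longrightarrow> (a \<otimes>\<^bsub>class_ring\<^esub> b) \<odot>\<^bsub>?V\<^esub> v = a \<odot>\<^bsub>?V\<^esub> (b \<odot>\<^bsub>?V\<^esub> v)"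
    by (auto simp: simps tensor_scale_scale)
  show "\<forall>v\<in>carrier ?V. \<one>\<^bsub>class_ring\<^esub> \<odot>\<^bsub>?V\<^esub> v = v"
    by (auto simp: simps tensor_scale_one)
  show "\<forall>a b v. a \<in> carrier (class_ring :: rat ring) \<and> b \<in> carrier (class_ring :: rat ring) \<and>
      v \<in> carrier ?V \<longrightarrow> (a \<oplus>\<^bsub>class_ring\<^esub> b) \<odot>\<^bsub>?V\<^esub> v = a \<odot>\<^bsub>?V\<^esub> v \<oplus>\<^bsub>?V\<^esub> b \<odot>\<^bsub>?V\<^esub> v"
    using distrib by (auto simp: simps)
  show "\<forall>a v w. a \<in> carrier (class_ring :: rat ring) \<and> v \<in> carrier ?V \<and> w \<in> carrier ?V \<longrightarrow>
      a \<odot>\<^bsub>?V\<^esub> (v \<oplus>\<^bsub>?V\<^esub> w) = a \<odot>\<^bsub>?V\<^esub> v \<oplus>\<^bsub>?V\<^esub> a \<odot>\<^bsub>?V\<^esub> w"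
    by (auto simp: simps tensor_scale_add)
qed

text \<open>The classes of \<open>(1, s)\<close> for generators \<open>s\<close> span. Finite
  dimension is the condition under which the size of an independent set is later compared with
  \<open>V.dim\<close>.\<close>

lemma fin_dim_rat_tensor:
  assumes S: "finite S" "S \<subseteq> carrier G" "generate G S = carrier G"
  shows "vectorspace.fin_dim (class_ring :: rat ring) (rat_tensor G)"
proof -
  let ?V = "rat_tensor G"
  interpret V: vectorspace "class_ring :: rat ring" ?V by (rule vectorspace_rat_tensor)
  define A where "A = (\<lambda>s. tensor_coset G (frag_of (1, s))) ` S"
  have A: "A \<subseteq> carrier ?V"
    using S(2) frags_of by (auto simp: A_def rat_tensor_carrier)
  have sub: "submodule class_ring (V.span A) ?V"
    by (rule V.span_is_submodule[OF A])
  note add = submodule.m_closed[OF sub] and zero = submodule.zero_closed[OF sub]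
    and smult = submodule.smult_closed[OF sub]
  have eq: "tensor_coset G c \<in> V.span A"
    if "c - c' \<in> tensor_relations G" "tensor_coset G c' \<in> V.span A" for c c'
    using that tensor_coset_eq_iff by metis
  have Z: "tensor_coset G 0 \<in> V.span A" using zero by (simp add: rat_tensor_zero)
  have of_in: "tensor_coset G (frag_of (a, g)) \<in> V.span A" if "g \<in> carrier G" for a g
  proof -
    have "g \<in> generate G S" using that S(3) by simp
    then have "g \<in> carrier G \<and> (\<forall>a. tensor_coset G (frag_of (a, g)) \<in> V.span A)"
    proof (induction rule: generate.induct)
      case one
      have "frag_of (a, \<one>) - 0 \<in> tensor_relations G" for a
        using tensor_relations_minus[OF tensor_relation_right[of \<one> \<one> a]] by simp
      then show ?case using eq Z by blast
    next
      case (incl h)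
      then have h: "h \<in> carrier G" using S(2) by blast
      have "tensor_coset G (frag_of (1, h)) \<in> V.span A"
        using incl A V.in_own_span[OF A] by (auto simp: A_def)
      then have "a \<odot>\<^bsub>?V\<^esub> tensor_coset G (frag_of (1, h)) \<in> V.span A" for a
        using smult by simp
      then show ?case using h frags_of[OF h] by (simp add: rat_tensor_smult tensor_scale_of)
    next
      case (inv h)
      then have h: "h \<in> carrier G" using S(2) by blast
      have "tensor_coset G (frag_of (1, h)) \<in> V.span A"
        using inv A V.in_own_span[OF A] by (auto simp: A_def)
      then have "a \<odot>\<^bsub>?V\<^esub> tensor_coset G (frag_of (1, h)) \<in> V.span A" for a
        using smult by simp
      then have *: "tensor_coset G (frag_of (- a, h)) \<in> V.span A" for a
        using h frags_of[OF h] by (simp add: rat_tensor_smult tensor_scale_of)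
      \<comment> \<open>Moving the inverse into the rational slot uses that symbols with rational
        entry 0 and symbols with group entry \<open>\<one>\<close> lie in the relations.\<close>
      have "frag_of (a, inv h) - frag_of (- a, h) \<in> tensor_relations G" for a
      proof -
        have 1: "frag_of (a, \<one>) - frag_of (a, h) - frag_of (a, inv h) \<in> tensor_relations G"
          using tensor_relation_right[of h "inv h" a] h by simp
        have 2: "frag_of (0, h) - frag_of (- a, h) - frag_of (a, h) \<in> tensor_relations G"
          using tensor_relation_left[of h "-a" a] h by simp
        have 3: "- frag_of (0, h) \<in> tensor_relations G"
          using tensor_relation_left[of h 0 0] h by simp
        have 4: "- frag_of (a, \<one>) \<in> tensor_relations G"
          using tensor_relation_right[of \<one> \<one> a] by simp
        have "frag_of (a, inv h) - frag_of (- a, h) =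
            (frag_of (0, h) - frag_of (- a, h) - frag_of (a, h)) + (- frag_of (0, h))
            - (frag_of (a, \<one>) - frag_of (a, h) - frag_of (a, inv h)) - (- frag_of (a, \<one>))"
          by (simp add: algebra_simps)
        then show ?thesis
          using 1 2 3 4 tensor_relations_add tensor_relations_diff by metis
      qed
      then show ?case using * h eq by blast
    next
      case (eng h1 h2)
      have "tensor_coset G (frag_of (a, h1)) \<oplus>\<^bsub>?V\<^esub> tensor_coset G (frag_of (a, h2)) \<in> V.span A" for a
        using eng add by blast
      then have *: "tensor_coset G (frag_of (a, h1) + frag_of (a, h2)) \<in> V.span A" for a
        using eng frags_of by (simp add: rat_tensor_add)
      have "frag_of (a, h1 \<otimes> h2) - (frag_of (a, h1) + frag_of (a, h2)) \<in> tensor_relations G" for a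
        using tensor_relation_right[of h1 h2 a] eng by (simp add: diff_diff_add)
      then show ?case using * eq eng by blast
    qed
    then show ?thesis by blast
  qed
  have "tensor_coset G c \<in> V.span A" if "c \<in> frags" for c
    using that
  proof (induction c rule: frags_induct)
    case zero
    show ?case by (rule Z)
  next
    case (diff x y)
    have "tensor_coset G x \<oplus>\<^bsub>?V\<^esub> ((-1) \<odot>\<^bsub>?V\<^esub> tensor_coset G y) \<in> V.span A"
      using diff by (intro add smult) auto
    then have *: "tensor_coset G (x + tensor_scale (-1) y) \<in> V.span A"
      using diff by (simp add: rat_tensor_smult rat_tensor_add tensor_scale_frags)
    \<comment> \<open>The first relation contains the term \<open>tensor_scale 0 y\<close>; the
      second equals the negative of that term and cancels it.\<close>
    have "tensor_scale (-1 + 1) y - tensor_scale (-1) y - tensor_scale 1 y \<in> tensor_relations G"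
      "tensor_scale (0 + 0) y - tensor_scale 0 y - tensor_scale 0 y \<in> tensor_relations G"
      using diff tensor_scale_distrib by blast+
    from tensor_relations_add[OF this]
    have "(x - y) - (x + tensor_scale (-1) y) \<in> tensor_relations G"
      using diff by (simp add: tensor_scale_one algebra_simps)
    then show ?case using * eq by blast
  next
    case (of a g)
    then show ?case by (rule of_in)
  qed
  then have "carrier ?V \<subseteq> V.span A" by (auto simp: rat_tensor_carrier)
  then have "V.span A = carrier ?V" using submodule.subset[OF sub] by blast
  moreover have "finite A" unfolding A_def using S(1) by (rule finite_imageI)
  ultimately show ?thesis unfolding V.fin_dim_def by (intro exI[of _ A] conjI A)
qed

text \<open>The map \<open>(a, g)\<close> to \<open>a * of_int (p g)\<close> extends to formal sums
  by the universal property, and bilinearity makes it vanish on the relations.\<close>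

lemma rat_tensor_functional:
  assumes hom: "\<And>g h. g \<in> carrier G \<Longrightarrow> h \<in> carrier G \<Longrightarrow> p (g \<otimes> h) = p g + (p h :: int)"
  obtains \<psi> where
    "\<And>v w. v \<in> carrier (rat_tensor G) \<Longrightarrow> w \<in> carrier (rat_tensor G) \<Longrightarrow>
       \<psi> (v \<oplus>\<^bsub>rat_tensor G\<^esub> w) = \<psi> v + (\<psi> w :: rat)"
    "\<And>q v. v \<in> carrier (rat_tensor G) \<Longrightarrow> \<psi> (q \<odot>\<^bsub>rat_tensor G\<^esub> v) = q * \<psi> v"
    "\<And>a g. g \<in> carrier G \<Longrightarrow> \<psi> (tensor_coset G (frag_of (a, g))) = a * of_int (p g)"
proof -
  define Q :: "rat monoid" where "Q = \<lparr>carrier = UNIV, mult = (+), one = 0\<rparr>"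
  interpret Q: comm_group Q
    by (rule comm_groupI) (auto simp: Q_def intro: exI[of _ "- x" for x])
  obtain \<phi> where \<phi>: "\<phi> \<in> hom (tensor_free G) Q"
    and \<phi>_of: "\<And>x. x \<in> UNIV \<times> carrier G \<Longrightarrow> \<phi> (frag_of x) = (\<lambda>(a, g). a * of_int (p g)) x"
    using Q.free_Abelian_group_universal[of "\<lambda>(a, g). a * of_int (p g)" "UNIV \<times> carrier G"]
    by (auto simp: Q_def)
  have add: "\<phi> (c + c') = \<phi> c + \<phi> c'" if "c \<in> frags" "c' \<in> frags" for c c'
    using hom_mult[OF \<phi> that] by (simp add: Q_def)
  have \<phi>_diff: "\<phi> (c - c') = \<phi> c - \<phi> c'" if "c \<in> frags" "c' \<in> frags" for c c'
    using add[OF frags_diff[OF that] that(2)] by simp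
  have rel: "\<phi> r = 0" if "r \<in> tensor_relations G" for r
    by (rule additive_zero_on_tensor_relations[OF add _ _ that])
      (auto simp: \<phi>_diff frags_diff frags_of \<phi>_of distrib_right hom distrib_left)
  have scale: "\<phi> (tensor_scale q c) = q * \<phi> c" if "c \<in> frags" for q c
    using that
  proof (induction c rule: frags_induct)
    case zero
    show ?case using rel[OF tensor_relations_zero] by (simp add: tensor_scale_zero)
  next
    case (diff x y)
    then show ?case by (simp add: tensor_scale_diff \<phi>_diff tensor_scale_frags right_diff_distrib)
  next
    case (of a g)
    then show ?case by (simp add: tensor_scale_of \<phi>_of)
  qed
  define \<psi> where "\<psi> v = \<phi> (SOME c. c \<in> frags \<and> tensor_coset G c = v)" for v
  have \<psi>: "\<psi> (tensor_coset G c) = \<phi> c" if c: "c \<in> frags" for c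
  proof -
    define c' where "c' = (SOME c'. c' \<in> frags \<and> tensor_coset G c' = tensor_coset G c)"
    have "c' \<in> frags \<and> tensor_coset G c' = tensor_coset G c"
      unfolding c'_def by (rule someI[of _ c]) (use c in simp)
    then have "c' \<in> frags" "\<phi> (c' - c) = 0"
      using rel by (simp_all add: tensor_coset_eq_iff)
    then show ?thesis
      using \<phi>_diff c unfolding \<psi>_def c'_def[symmetric] by simp
  qed
  show ?thesis
  proof
    show "\<psi> (v \<oplus>\<^bsub>rat_tensor G\<^esub> w) = \<psi> v + \<psi> w"
      if "v \<in> carrier (rat_tensor G)" "w \<in> carrier (rat_tensor G)" for v w
      using that by (auto simp: rat_tensor_carrier rat_tensor_add \<psi> add frags_add
)
    show "\<psi> (q \<odot>\<^bsub>rat_tensor G\<^esub> v) = q * \<psi> v" if "v \<in> carrier (rat_tensor G)" for q v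
      using that by (auto simp: rat_tensor_carrier rat_tensor_smult \<psi> scale tensor_scale_frags
)
    show "\<psi> (tensor_coset G (frag_of (a, g))) = a * of_int (p g)" if "g \<in> carrier G" for a g
      using that by (simp add: \<psi> \<phi>_of)
  qed
qed

text \<open>The functionals induced by the coordinates are dual, up to the factor \<open>M\<close>,
  to the classes of \<open>(1, b)\<close>. Applying them to a linear relation shows that these
  classes are independent.\<close>

lemma card_le_group_rank:
  fixes p :: "'a \<Rightarrow> 'a \<Rightarrow> int"
  assumes S: "finite S" "S \<subseteq> carrier G" "generate G S = carrier G"
    and B: "finite B" "B \<subseteq> carrier G"
    and hom: "\<And>g h b. g \<in> carrier G \<Longrightarrow> h \<in> carrier G \<Longrightarrow> b \<in> B \<Longrightarrow> p (g \<otimes> h) b = p g b + p h b"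
    and dual: "\<And>b b'. b \<in> B \<Longrightarrow> b' \<in> B \<Longrightarrow> p b b' = (if b = b' then M else 0)"
    and M: "M > 0"
  shows "card B \<le> group_rank G"
proof -
  let ?V = "rat_tensor G"
  interpret V: vectorspace "class_ring :: rat ring" ?V by (rule vectorspace_rat_tensor)
  define functional where "functional b \<psi> \<longleftrightarrow>
      (\<forall>v w. v \<in> carrier ?V \<longrightarrow> w \<in> carrier ?V \<longrightarrow> \<psi> (v \<oplus>\<^bsub>?V\<^esub> w) = \<psi> v + (\<psi> w :: rat)) \<and>
      (\<forall>q v. v \<in> carrier ?V \<longrightarrow> \<psi> (q \<odot>\<^bsub>?V\<^esub> v) = q * \<psi> v) \<and>
      (\<forall>a g. g \<in> carrier G \<longrightarrow> \<psi> (tensor_coset G (frag_of (a, g))) = a * of_int (p g b))"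
    for b \<psi>
  have "\<exists>\<psi>. functional b \<psi>" if b: "b \<in> B" for b
    by (rule rat_tensor_functional[of "\<lambda>g. p g b"], rule hom[OF _ _ b], assumption, assumption)
      (unfold functional_def, blast)
  then obtain \<psi> where \<psi>: "\<And>b. b \<in> B \<Longrightarrow> functional b (\<psi> b)"
    using bchoice[of B functional] by blast
  have add: "\<psi> b (v \<oplus>\<^bsub>?V\<^esub> w) = \<psi> b v + \<psi> b w"
    if "b \<in> B" "v \<in> carrier ?V" "w \<in> carrier ?V" for b v w
    using \<psi>[OF that(1)] that unfolding functional_def by simp
  have smult: "\<psi> b (q \<odot>\<^bsub>?V\<^esub> v) = q * \<psi> b v" if "b \<in> B" "v \<in> carrier ?V" for b q v
    using \<psi>[OF that(1)] that unfolding functional_def by simp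
  have of: "\<psi> b (tensor_coset G (frag_of (a, g))) = a * of_int (p g b)"
    if "b \<in> B" "g \<in> carrier G" for b a g
    using \<psi>[OF that(1)] that unfolding functional_def by simp
  define e where "e b = tensor_coset G (frag_of (1, b))" for b
  have e: "e b \<in> carrier ?V" if "b \<in> B" for b
    using that B frags_of unfolding e_def rat_tensor_carrier by blast
  have \<psi>e: "\<psi> b (e b') = (if b' = b then of_int M else 0)" if "b \<in> B" "b' \<in> B" for b b'
    using of[of b b' 1] that B dual[of b' b] unfolding e_def by auto
  have inj: "inj_on e B"
  proof (rule inj_onI)
    fix b b' assume b: "b \<in> B" "b' \<in> B" "e b = e b'"
    then have "\<psi> b (e b') = of_int M" using \<psi>e[of b b] by simp
    with \<psi>e[OF b(1,2)] M show "b = b'" by (cases "b' = b") simp_all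
  qed
  have zero: "\<psi> b \<zero>\<^bsub>?V\<^esub> = 0" if "b \<in> B" for b
    using smult[OF that V.zero_closed, of 0] V.lmult_0[OF V.zero_closed] by simp
  have sum: "\<psi> b (V.lincomb a (e ` C)) = (\<Sum>b'\<in>C. a (e b') * \<psi> b (e b'))"
    if b: "b \<in> B" and C: "C \<subseteq> B" for b C a
  proof -
    have "finite C" using C B finite_subset by blast
    then show ?thesis using C
    proof (induction C)
      case empty
      then show ?case using zero[OF b] by (simp add: V.lincomb_def)
    next
      case (insert c C)
      have eC: "e c \<notin> e ` C" using insert inj by (auto simp: inj_on_def)
      have carr: "e c \<in> carrier ?V" "e ` C \<subseteq> carrier ?V" using e insert by auto
      have "V.lincomb a (e ` insert c C) = a (e c) \<odot>\<^bsub>?V\<^esub> e c \<oplus>\<^bsub>?V\<^esub> V.lincomb a (e ` C)"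
        unfolding V.lincomb_def using insert eC carr
        by (simp, subst V.finsum_insert) (auto intro!: V.smult_closed)
      moreover have "V.lincomb a (e ` C) \<in> carrier ?V"
        using carr insert by (intro V.lincomb_closed) auto
      ultimately show ?case
        using insert carr add[OF b] smult[OF b] V.smult_closed[OF _ carr(1)] by simp
    qed
  qed
  have "V.lin_indpt (e ` B)"
  proof
    assume "V.lin_dep (e ` B)"
    then obtain A a v where *: "finite A" "A \<subseteq> e ` B" "V.lincomb a A = \<zero>\<^bsub>?V\<^esub>" "v \<in> A" "a v \<noteq> 0"
      unfolding V.lin_dep_def by auto
    obtain C where C: "C \<subseteq> B" "A = e ` C" using *(2) subset_imageE by metis
    obtain c where c: "c \<in> C" "v = e c" using * C by auto
    then have cB: "c \<in> B" using C by auto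
    have "0 = (\<Sum>b'\<in>C. a (e b') * \<psi> c (e b'))"
      using sum[OF cB C(1), of a] * C zero[OF cB] by simp
    also have "\<dots> = (\<Sum>b'\<in>C. if b' = c then a (e b') * of_int M else 0)"
      using C cB by (intro sum.cong refl) (auto simp: \<psi>e)
    also have "\<dots> = a v * of_int M"
      using C B c finite_subset[of C B] by (simp add: sum.delta)
    finally show False using * M by simp
  qed
  then have "card (e ` B) \<le> V.dim"
    using V.li_le_dim[OF fin_dim_rat_tensor[OF S], of "e ` B"] e by auto
  then show ?thesis unfolding group_rank_def using card_image[OF inj] by simp
qed

end

section \<open>Lattice coordinates\<close>

context comm_group
begin

definition word :: "'a set \<Rightarrow> ('a \<Rightarrow> int) \<Rightarrow> 'a" where
  "word S n = (\<Otimes>s\<in>S. s [^] n s)"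

context
  fixes S assumes S: "finite S" "S \<subseteq> carrier G"
begin

lemma word_closed [simp]: "word S n \<in> carrier G"
  unfolding word_def using S by (intro finprod_closed) auto

lemma word_add: "word S (\<lambda>s. n s + m s) = word S n \<otimes> word S m"
proof -
  have "word S (\<lambda>s. n s + m s) = (\<Otimes>s\<in>S. s [^] n s \<otimes> s [^] m s)"
    unfolding word_def using S by (intro finprod_cong) (auto simp: int_pow_mult simp_implies_def)
  also have "\<dots> = word S n \<otimes> word S m"
    unfolding word_def using S by (intro finprod_multf) auto
  finally show ?thesis .
qed

lemma word_cong: "(\<And>s. s \<in> S \<Longrightarrow> n s = m s) \<Longrightarrow> word S n = word S m"
  unfolding word_def using S by (intro finprod_cong) (auto simp: simp_implies_def)

lemma word_zero: "(\<And>s. s \<in> S \<Longrightarrow> n s = 0) \<Longrightarrow> word S n = \<one>"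
  unfolding word_def by (intro finprod_one_eqI) simp

lemma word_scale: "word S (\<lambda>s. k * n s) = word S n [^] (k :: int)"
proof -
  have "(\<Otimes>s\<in>C. s [^] (k * n s)) = (\<Otimes>s\<in>C. s [^] n s) [^] k" if "C \<subseteq> S" for C
  proof -
    have "finite C" using that S finite_subset by blast
    then show ?thesis using that
    proof (induction C)
      case empty
      show ?case by simp
    next
      case (insert c C)
      have C: "(\<lambda>s. s [^] m s) \<in> C \<rightarrow> carrier G" "c \<in> carrier G" for m :: "'a \<Rightarrow> int"
        using insert S by auto
      then have "(\<Otimes>s\<in>insert c C. s [^] (k * n s)) = c [^] (n c * k) \<otimes> (\<Otimes>s\<in>C. s [^] (k * n s))"
        using insert by (simp add: mult.commute)
      also have "\<dots> = (c [^] n c \<otimes> (\<Otimes>s\<in>C. s [^] n s)) [^] k"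
        using C insert by (simp add: int_pow_distrib int_pow_pow)
      also have "c [^] n c \<otimes> (\<Otimes>s\<in>C. s [^] n s) = (\<Otimes>s\<in>insert c C. s [^] n s)"
        using C insert by simp
      finally show ?case .
    qed
  qed
  from this[OF subset_refl] show ?thesis unfolding word_def .
qed

lemma word_diff: "word S (\<lambda>s. n s - m s) = word S n \<otimes> inv word S m"
proof -
  have "word S (\<lambda>s. n s - m s) = word S n \<otimes> word S (\<lambda>s. - 1 * m s)"
    using word_add[of n "\<lambda>s. - 1 * m s"] by simp
  then show ?thesis unfolding word_scale by (simp add: int_pow_neg)
qed

lemma word_single: "t \<in> S \<Longrightarrow> word S (\<lambda>s. if s = t then k else 0) = t [^] k"
proof -
  assume t: "t \<in> S"
  have "word S (\<lambda>s. if s = t then k else 0) = (\<Otimes>s\<in>S. if t = s then s [^] k else \<one>)"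
    unfolding word_def using S by (intro finprod_cong) (auto simp: simp_implies_def)
  also have "\<dots> = t [^] k"
    using finprod_singleton[OF t S(1), of "\<lambda>s. s [^] k"] S by auto
  finally show ?thesis .
qed

lemma word_sum:
  "finite C \<Longrightarrow> word S (\<lambda>s. \<Sum>t\<in>C. f t s) = (\<Otimes>t\<in>C. word S (f t))"
proof (induction C rule: finite_induct)
  case empty
  then show ?case by (simp add: word_zero)
next
  case (insert c C)
  then show ?case by (simp add: word_add)
qed

lemma generate_word:
  assumes "g \<in> generate G S" shows "\<exists>n. g = word S n"
  using assms
proof (induction rule: generate.induct)
  case one
  then show ?case using word_zero[of "\<lambda>_. 0"] by metis
next
  case (incl h)
  then show ?case using word_single[of h 1] S by (metis int_pow_1 subsetD)
next
  case (inv h)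
  then have "word S (\<lambda>s. if s = h then -1 else 0) = inv h"
    using word_single[of h "-1"] S by (simp add: int_pow_neg subset_iff)
  then show ?case by metis
next
  case (eng h1 h2)
  then show ?case using word_add by metis
qed

end

text \<open>Take \<open>B\<close> maximal among the subsets of \<open>S\<close> without a nontrivial
  multiplicative relation. By maximality some positive power of each generator is a word in
  \<open>B\<close>, and one exponent \<open>M\<close> serves all of them. Then \<open>p g\<close> is
  the exponent vector of \<open>g [^] M\<close>, unique by independence. This gives coordinates
  modulo torsion without a structure theorem.\<close>

lemma lattice_coordinates:
  assumes S: "finite S" "S \<subseteq> carrier G" "generate G S = carrier G"
  obtains B and p :: "'a \<Rightarrow> 'a \<Rightarrow> int" and M :: int where
    "finite B" "B \<subseteq> carrier G" "M > 0"
    "\<And>g h b. g \<in> carrier G \<Longrightarrow> h \<in> carrier G \<Longrightarrow> p (g \<otimes> h) b = p g b + p h b"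
    "\<And>b b'. b \<in> B \<Longrightarrow> b' \<in> B \<Longrightarrow> p b b' = (if b = b' then M else 0)"
    "\<And>n. \<exists>g\<in>carrier G. \<forall>b\<in>B. p g b = M * n b"
    "\<And>R. finite {g \<in> carrier G. \<forall>b\<in>B. \<bar>p g b\<bar> \<le> R}"
proof -
  note S' = S(1,2)
  define supp where "supp C n \<longleftrightarrow> (\<forall>s. s \<notin> C \<longrightarrow> n s = 0)" for C and n :: "'a \<Rightarrow> int"
  define ind where "ind C \<longleftrightarrow> (\<forall>n. supp C n \<longrightarrow> word S n = \<one> \<longrightarrow> (\<forall>s. n s = 0))" for C
  define P where "P C \<longleftrightarrow> C \<subseteq> S \<and> ind C" for C
  have "P {}" unfolding P_def ind_def supp_def by simp
  moreover have "card C \<le> card S" if "P C" for C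
    using that S card_mono unfolding P_def by blast
  ultimately obtain B where "P B" and max: "\<And>C. P C \<Longrightarrow> card C \<le> card B"
    using ex_has_greatest_nat[of P "{}" card "card S + 1"] by (metis le_imp_less_Suc Suc_eq_plus1)
  then have BS: "B \<subseteq> S" and indB: "ind B" unfolding P_def by auto
  have finB: "finite B" using BS S finite_subset by blast
  have "\<exists>m n. m > (0::int) \<and> supp B n \<and> word S n = t [^] m" if t: "t \<in> S" for t
  proof (cases "t \<in> B")
    case True
    then have "supp B (\<lambda>s. if s = t then 1 else 0)" by (auto simp: supp_def)
    then show ?thesis using word_single[OF S' t, of 1] by (intro exI[of _ 1]) auto
  next
    case False
    then have "\<not> P (insert t B)" using max[of "insert t B"] finB by auto
    then obtain n s where n: "supp (insert t B) n" "word S n = \<one>" "n s \<noteq> 0"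
      unfolding P_def ind_def using BS t by auto
    have nt: "n t \<noteq> 0"
    proof
      assume "n t = 0"
      with n(1) have "supp B n" by (auto simp: supp_def)
      then show False using indB n unfolding ind_def by blast
    qed
    \<comment> \<open>Dropping the entry of \<open>t\<close> from the relation leaves a word in
      \<open>B\<close> equal to a power of \<open>t\<close>; the sign \<open>k\<close> turns the
      exponent into \<open>\<bar>n t\<bar>\<close>.\<close>
    define k where "k = - sgn (n t)"
    define n' where "n' s = k * (n s - (if s = t then n t else 0))" for s
    have "word S n' = (word S n \<otimes> inv (t [^] n t)) [^] k"
      unfolding n'_def word_scale[OF S'] word_diff[OF S'] word_single[OF S' t] ..
    also have "\<dots> = t [^] (- n t * k)"
      using n t S by (simp add: int_pow_pow int_pow_neg[symmetric] subset_iff)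
    finally have "word S n' = t [^] \<bar>n t\<bar>" by (simp add: k_def abs_sgn)
    moreover have "supp B n'" using n(1) by (auto simp: supp_def n'_def)
    ultimately show ?thesis using nt by (intro exI[of _ "\<bar>n t\<bar>"]) auto
  qed
  then obtain m e where m: "\<And>t. t \<in> S \<Longrightarrow> m t > (0::int)"
    and e: "\<And>t. t \<in> S \<Longrightarrow> supp B (e t)" "\<And>t. t \<in> S \<Longrightarrow> word S (e t) = t [^] m t" by metis
  define M where "M = (\<Prod>t\<in>S. m t)"
  have M: "M > 0" unfolding M_def using m by (simp add: prod_pos)
  have div: "M div m t * m t = M" if "t \<in> S" for t
    unfolding M_def using that S by (intro dvd_div_mult_self dvd_prodI) auto
  define f where "f t s = (M div m t) * e t s" for t s
  have f: "supp B (f t)" "word S (f t) = t [^] M" if "t \<in> S" for t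
  proof -
    show "supp B (f t)" using e(1)[OF that] by (auto simp: supp_def f_def)
    have "word S (f t) = (t [^] m t) [^] (M div m t)"
      unfolding f_def word_scale[OF S'] e(2)[OF that] ..
    also have "\<dots> = t [^] M"
      using that S div[OF that] by (simp add: int_pow_pow subset_iff mult.commute)
    finally show "word S (f t) = t [^] M" .
  qed
  have ex: "\<exists>n. supp B n \<and> word S n = g [^] M" if "g \<in> carrier G" for g
  proof -
    obtain a where a: "g = word S a" using generate_word[OF S', of g] \<open>g \<in> carrier G\<close> unfolding S(3) by blast
    define n where "n s = (\<Sum>t\<in>S. a t * f t s)" for s
    have supp: "supp B n" using f(1) by (auto simp: supp_def n_def)
    have "word S n = (\<Otimes>t\<in>S. word S (f t) [^] a t)"
      unfolding n_def word_sum[OF S' S(1)] word_scale[OF S'] ..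
    also have "\<dots> = (\<Otimes>t\<in>S. t [^] (M * a t))"
      using S by (intro finprod_cong) (auto simp: f int_pow_pow simp_implies_def)
    also have "\<dots> = g [^] M"
      using word_scale[OF S', of M a] unfolding a by (simp add: word_def)
    finally show ?thesis using supp by blast
  qed
  have uniq: "n = n'" if "supp B n" "supp B n'" "word S n = word S n'" for n n'
  proof -
    have "word S (\<lambda>s. n s - n' s) = \<one>"
      unfolding word_diff[OF S'] that(3) using word_closed[OF S'] by simp
    moreover have "supp B (\<lambda>s. n s - n' s)" using that by (auto simp: supp_def)
    ultimately have "\<forall>s. n s - n' s = 0" using indB unfolding ind_def by blast
    then show ?thesis by auto
  qed
  define p where "p g = (SOME n. supp B n \<and> word S n = g [^] M)" for g
  have p: "supp B (p g)" "word S (p g) = g [^] M" if "g \<in> carrier G" for g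
    using someI_ex[OF ex[OF that]] unfolding p_def by auto
  have p_eqI: "p g = n" if "g \<in> carrier G" "supp B n" "word S n = g [^] M" for g n
    using uniq[OF p(1) _ ] p that by simp
  have hom: "p (g \<otimes> h) = (\<lambda>b. p g b + p h b)" if "g \<in> carrier G" "h \<in> carrier G" for g h
    using that p[of g] p[of h]
    by (intro p_eqI) (auto simp: supp_def word_add[OF S'] int_pow_distrib)
  have dual: "p b b' = (if b = b' then M else 0)" if "b \<in> B" for b b'
  proof -
    have "b \<in> S" using that BS by blast
    then have "p b = (\<lambda>s. if s = b then M else 0)"
      using that S by (intro p_eqI) (auto simp: word_single[OF S'] supp_def)
    then show ?thesis by simp
  qed
  have scale: "p (word S n) = (\<lambda>s. M * n s)" if "supp B n" for n
    using that by (intro p_eqI) (auto simp: supp_def word_closed[OF S'] word_scale[OF S'])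
  have surj: "\<exists>g\<in>carrier G. \<forall>b\<in>B. p g b = M * n b" for n
  proof (intro bexI ballI)
    show "p (word S (\<lambda>s. if s \<in> B then n s else 0)) b = M * n b" if "b \<in> B" for b
      using scale[of "\<lambda>s. if s \<in> B then n s else 0"] that by (simp add: supp_def)
  qed (rule word_closed[OF S'])
  have fin: "finite {g \<in> carrier G. \<forall>b\<in>B. \<bar>p g b\<bar> \<le> R}" for R
  proof -
    \<comment> \<open>Dividing all exponents by \<open>M\<close> with remainder writes
      \<open>g\<close> as \<open>r \<otimes> h [^] M\<close> with \<open>r\<close> in the finite set
      \<open>D\<close>, and \<open>h [^] M\<close> is the word of \<open>p h\<close>. A bound on
      \<open>p g\<close> therefore bounds \<open>p h\<close>.\<close>
    define D where "D = word S ` (S \<rightarrow>\<^sub>E {0..<M})"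
    have finD: "finite D" unfolding D_def using S(1) by (intro finite_imageI finite_PiE) auto
    define R' where "R' = R + (\<Sum>g\<in>D. \<Sum>b\<in>B. \<bar>p g b\<bar>)"
    have bound: "\<bar>p g b\<bar> \<le> R' - R" if "g \<in> D" "b \<in> B" for g b
    proof -
      have "\<bar>p g b\<bar> \<le> (\<Sum>b\<in>B. \<bar>p g b\<bar>)" using that finB by (intro member_le_sum) auto
      also have "\<dots> \<le> (\<Sum>g\<in>D. \<Sum>b\<in>B. \<bar>p g b\<bar>)"
        using that finD by (intro member_le_sum[of g D "\<lambda>g. \<Sum>b\<in>B. \<bar>p g b\<bar>"]) (auto intro: sum_nonneg)
      finally show ?thesis by (simp add: R'_def)
    qed
    define N where "N = {n. supp B n \<and> (\<forall>b\<in>B. \<bar>n b\<bar> \<le> R')}"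
    have "finite N"
    proof (rule finite_subset)
      show "N \<subseteq> (\<lambda>n s. if s \<in> B then n s else 0) ` (B \<rightarrow>\<^sub>E {-R'..R'})"
      proof
        fix n assume "n \<in> N"
        then show "n \<in> (\<lambda>n s. if s \<in> B then n s else 0) ` (B \<rightarrow>\<^sub>E {-R'..R'})"
          by (intro image_eqI[of _ _ "restrict n B"]) (auto simp: N_def supp_def abs_le_iff fun_eq_iff)
      qed
      show "finite ((\<lambda>n s. if s \<in> B then n s else (0::int)) ` (B \<rightarrow>\<^sub>E {-R'..R'}))"
        using finB by (intro finite_imageI finite_PiE) auto
    qed
    have "{g \<in> carrier G. \<forall>b\<in>B. \<bar>p g b\<bar> \<le> R} \<subseteq> (\<lambda>(g, n). g \<otimes> word S n) ` (D \<times> N)"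
    proof
      fix g assume "g \<in> {g \<in> carrier G. \<forall>b\<in>B. \<bar>p g b\<bar> \<le> R}"
      then have g: "g \<in> carrier G" and gR: "\<And>b. b \<in> B \<Longrightarrow> \<bar>p g b\<bar> \<le> R" by auto
      obtain a where a: "g = word S a" using generate_word[OF S', of g] g unfolding S(3) by blast
      define r where "r = word S (\<lambda>s. a s mod M)"
      define h where "h = word S (\<lambda>s. a s div M)"
      have h: "h \<in> carrier G" and r: "r \<in> carrier G" by (simp_all add: h_def r_def word_closed[OF S'])
      have "r = word S (restrict (\<lambda>s. a s mod M) S)" unfolding r_def by (rule word_cong[OF S']) simp
      then have rD: "r \<in> D" unfolding D_def using M by (auto simp: restrict_def)
      have "g = word S (\<lambda>s. a s mod M + M * (a s div M))" unfolding a by simp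
      then have "g = r \<otimes> h [^] M"
        unfolding word_add[OF S'] word_scale[OF S'] r_def h_def .
      then have gr: "g = r \<otimes> word S (p h)" using p(2)[OF h] by simp
      have "p g b = p r b + M * p h b" for b
        unfolding gr using hom[OF r word_closed[OF S']] scale[OF p(1)[OF h]] by simp
      then have "\<bar>M * p h b\<bar> \<le> R'" if "b \<in> B" for b
        using gR[OF that] bound[OF rD that] by (smt (verit))
      moreover have "\<bar>p h b\<bar> \<le> \<bar>M * p h b\<bar>" for b
        using M by (simp add: abs_mult mult_le_cancel_right1)
      ultimately have "p h \<in> N" using p(1)[OF h] unfolding N_def by (smt (verit) mem_Collect_eq)
      then show "g \<in> (\<lambda>(g, n). g \<otimes> word S n) ` (D \<times> N)"
        using gr rD by (intro image_eqI[of _ _ "(r, p h)"]) auto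
    qed
    then show ?thesis using finD \<open>finite N\<close> finite_subset by blast
  qed
  show ?thesis
    by (rule that[of B M p]) (use finB BS S(2) M hom dual surj fin in auto)
qed

end

section \<open>Linear algebra over a finite index set\<close>

text \<open>Elimination by induction on the equations: equation \<open>b\<close> is solved for an
  unknown \<open>i\<close> with nonzero coefficient, and the result is substituted into the
  others.\<close>

lemma homogeneous_system_nontrivial_solution:
  fixes f :: "'j \<Rightarrow> 'b \<Rightarrow> 'c::field"
  assumes "finite B" "finite J" "card B < card J"
  shows "\<exists>l. (\<exists>j\<in>J. l j \<noteq> 0) \<and> (\<forall>b\<in>B. (\<Sum>j\<in>J. l j * f j b) = 0)"
  using assms
proof (induction B arbitrary: J f rule: finite_induct)
  case empty
  then have "J \<noteq> {}" by auto
  then show ?case by (intro exI[of _ "\<lambda>_. 1"]) auto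
next
  case (insert b B)
  show ?case
  proof (cases "\<forall>j\<in>J. f j b = 0")
    case True
    obtain l where "\<exists>j\<in>J. l j \<noteq> 0" "\<forall>b\<in>B. (\<Sum>j\<in>J. l j * f j b) = 0"
      using insert.IH[of J f] insert.prems insert.hyps by auto
    then show ?thesis using True by (intro exI[of _ l]) (auto intro: sum.neutral)
  next
    case False
    then obtain i where i: "i \<in> J" "f i b \<noteq> 0" by blast
    have "card B < card (J - {i})" using insert.prems insert.hyps i by simp
    define f' where "f' j x = f j x - f j b / f i b * f i x" for j x
    obtain l where l: "\<exists>j\<in>J - {i}. l j \<noteq> 0"
      "\<forall>x\<in>B. (\<Sum>j\<in>J - {i}. l j * f' j x) = 0"
      using insert.IH[of "J - {i}" f'] insert.prems(1) \<open>card B < card (J - {i})\<close> by auto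
    define l' where "l' j = (if j = i then - (\<Sum>j\<in>J - {i}. l j * (f j b / f i b)) else l j)" for j
    have split: "(\<Sum>j\<in>J. l' j * f j x) = (\<Sum>j\<in>J - {i}. l j * f' j x)" for x
    proof -
      have "(\<Sum>j\<in>J. l' j * f j x) = l' i * f i x + (\<Sum>j\<in>J - {i}. l' j * f j x)"
        using insert.prems i by (simp add: sum.remove)
      also have "(\<Sum>j\<in>J - {i}. l' j * f j x) = (\<Sum>j\<in>J - {i}. l j * f j x)"
        by (intro sum.cong) (auto simp: l'_def)
      also have "l' i * f i x = - (\<Sum>j\<in>J - {i}. l j * (f j b / f i b) * f i x)"
        by (simp add: l'_def sum_distrib_right)
      finally show ?thesis
        by (simp add: f'_def right_diff_distrib sum_subtractf mult.assoc)
    qed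
    have "(\<Sum>j\<in>J. l' j * f j b) = 0"
      unfolding split using i by (intro sum.neutral) (simp add: f'_def)
    moreover have "\<exists>j\<in>J. l' j \<noteq> 0" using l(1) by (auto simp: l'_def)
    ultimately show ?thesis using l(2) split by (intro exI[of _ l']) auto
  qed
qed

text \<open>More than \<open>card B + 1\<close> vectors are affinely dependent. Subtracting the
  largest multiple of the dependence that keeps all weights nonnegative makes one weight vanish, and
  that index is removed.\<close>

lemma caratheodory_functions:
  fixes v :: "'j \<Rightarrow> 'b \<Rightarrow> real"
  assumes "finite B" "finite J" "\<forall>j\<in>J. c j \<ge> 0" "(\<Sum>j\<in>J. c j) = 1"
  shows "\<exists>J' c'. J' \<subseteq> J \<and> card J' \<le> card B + 1 \<and> (\<forall>j\<in>J'. c' j \<ge> 0) \<and> (\<Sum>j\<in>J'. c' j) = 1 \<and>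
    (\<forall>b\<in>B. (\<Sum>j\<in>J'. c' j * v j b) = (\<Sum>j\<in>J. c j * v j b))"
  using assms(2-)
proof (induction "card J" arbitrary: J c rule: less_induct)
  case less
  show ?case
  proof (cases "card J \<le> card B + 1")
    case True
    then show ?thesis using less.prems by (intro exI[of _ J] exI[of _ c]) auto
  next
    case False
    \<comment> \<open>The extra index \<open>None\<close> encodes the equation that the coefficients
      sum to zero, which preserves the total weight 1.\<close>
    define f where "f j x = (case x of None \<Rightarrow> 1 | Some b \<Rightarrow> v j b)" for j x
    have "card (insert None (Some ` B)) = card B + 1"
      using assms(1) by (subst card_insert_disjoint) (auto simp: card_image)
    then obtain l where l: "\<exists>j\<in>J. l j \<noteq> 0"
      "\<forall>x\<in>insert None (Some ` B). (\<Sum>j\<in>J. l j * f j x) = 0"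
      using homogeneous_system_nontrivial_solution[of "insert None (Some ` B)" J f]
        assms(1) less.prems False by auto
    have l0: "(\<Sum>j\<in>J. l j) = 0" using l(2) by (simp add: f_def)
    have lb: "(\<Sum>j\<in>J. l j * v j b) = 0" if "b \<in> B" for b using l(2) that by (auto simp: f_def)
    have pos: "\<exists>j\<in>J. l j > 0"
    proof (rule ccontr)
      assume "\<not> (\<exists>j\<in>J. l j > 0)"
      then have "\<forall>j\<in>J. - l j \<ge> 0" by force
      moreover have "(\<Sum>j\<in>J. - l j) = 0" using l0 by (simp add: sum_negf)
      ultimately have "\<forall>j\<in>J. - l j = 0"
        using sum_nonneg_eq_0_iff[OF less.prems(1), of "\<lambda>j. - l j"] by simp
      then show False using l(1) by simp
    qed
    define J0 where "J0 = {j \<in> J. l j > 0}"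
    have J0: "finite J0" "J0 \<noteq> {}" using pos less.prems by (auto simp: J0_def)
    define t where "t = Min ((\<lambda>j. c j / l j) ` J0)"
    have "t \<in> (\<lambda>j. c j / l j) ` J0" unfolding t_def using J0 by (intro Min_in) auto
    then obtain i where i: "i \<in> J" "l i > 0" "t = c i / l i" by (auto simp: J0_def)
    have t: "t \<ge> 0" using i less.prems by auto
    have tle: "t * l j \<le> c j" if "j \<in> J" for j
    proof (cases "l j > 0")
      case True
      then have "t \<le> c j / l j" unfolding t_def using J0 that by (intro Min_le) (auto simp: J0_def)
      then show ?thesis using True by (simp add: field_simps)
    next
      case False
      then have "t * l j \<le> 0" using t by (simp add: mult_nonneg_nonpos)
      then show ?thesis using less.prems that by force
    qed
    define c' where "c' j = c j - t * l j" for j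
    have c'i: "c' i = 0" using i by (simp add: c'_def)
    have sum': "(\<Sum>j\<in>J - {i}. c' j * w j) = (\<Sum>j\<in>J. c j * w j) - t * (\<Sum>j\<in>J. l j * w j)"
      for w :: "'j \<Rightarrow> real"
    proof -
      have "(\<Sum>j\<in>J - {i}. c' j * w j) = (\<Sum>j\<in>J. c' j * w j)"
        using less.prems i c'i by (simp add: sum.remove)
      then show ?thesis
        by (simp add: c'_def left_diff_distrib sum_subtractf sum_distrib_left mult.assoc)
    qed
    have "card (J - {i}) < card J" using i less.prems by (intro psubset_card_mono) auto
    moreover have "(\<Sum>j\<in>J - {i}. c' j) = 1" using sum'[of "\<lambda>_. 1"] less.prems l0 by simp
    ultimately obtain J' c'' where *: "J' \<subseteq> J - {i}" "card J' \<le> card B + 1" "\<forall>j\<in>J'. c'' j \<ge> 0"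
      "(\<Sum>j\<in>J'. c'' j) = 1" "\<forall>b\<in>B. (\<Sum>j\<in>J'. c'' j * v j b) = (\<Sum>j\<in>J - {i}. c' j * v j b)"
      using less.hyps[of "J - {i}" c'] less.prems tle unfolding c'_def by auto
    then show ?thesis using sum' lb by (intro exI[of _ J'] exI[of _ c'']) auto
  qed
qed

text \<open>Each new vector has almost nonpositive inner product with the current sum, so the squared
  norms of the partial sums grow only linearly and their averages tend to zero.\<close>

lemma greedy_small_sum:
  fixes N :: "('b \<Rightarrow> real) set"
  assumes "finite B"
    and unit: "\<And>v. v \<in> N \<Longrightarrow> (\<Sum>b\<in>B. (v b)\<^sup>2) \<le> 1"
    and half: "\<And>w. \<exists>v\<in>N. (\<Sum>b\<in>B. v b * w b) \<le> 1"
  shows "\<exists>v. (\<forall>i<k. v i \<in> N) \<and> (\<Sum>b\<in>B. (\<Sum>i<k. v i b)\<^sup>2) \<le> 3 * real k"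
proof (induction k)
  case 0
  then show ?case by simp
next
  case (Suc k)
  then obtain v where v: "\<forall>i<k. v i \<in> N" "(\<Sum>b\<in>B. (\<Sum>i<k. v i b)\<^sup>2) \<le> 3 * real k" by blast
  obtain u where u: "u \<in> N" "(\<Sum>b\<in>B. u b * (\<Sum>i<k. v i b)) \<le> 1"
    using half[of "\<lambda>b. \<Sum>i<k. v i b"] by (rule bexE)
  define v' where "v' = v(k := u)"
  have "(\<Sum>i<Suc k. v' i b) = (\<Sum>i<k. v i b) + u b" for b
    by (simp add: v'_def)
  then have "(\<Sum>b\<in>B. (\<Sum>i<Suc k. v' i b)\<^sup>2) =
      (\<Sum>b\<in>B. (\<Sum>i<k. v i b)\<^sup>2) + (\<Sum>b\<in>B. (u b)\<^sup>2) + 2 * (\<Sum>b\<in>B. u b * (\<Sum>i<k. v i b))"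
    by (simp add: power2_sum sum.distrib sum_distrib_left mult.commute mult.left_commute)
  also have "\<dots> \<le> 3 * real k + 1 + 2 * 1"
    using v(2) u(2) unit[OF u(1)] by (intro add_mono mult_left_mono) auto
  finally show ?case using v u by (intro exI[of _ v']) (auto simp: v'_def)
qed

text \<open>The average of \<open>k\<close> greedily chosen vectors has squared norm at most
  \<open>3 / k\<close>; Caratheodory's theorem then cuts it down to \<open>card B + 1\<close>
  vectors. That this number does not depend on \<open>e\<close> allows a later passage to the
  limit.\<close>

lemma approximate_zero_convex_combination:
  fixes N :: "('b \<Rightarrow> real) set"
  assumes B: "finite B"
    and unit: "\<And>v. v \<in> N \<Longrightarrow> (\<Sum>b\<in>B. (v b)\<^sup>2) \<le> 1"
    and half: "\<And>w. \<exists>v\<in>N. (\<Sum>b\<in>B. v b * w b) \<le> 1"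
    and e: "e > 0"
  shows "\<exists>c v. (\<forall>i\<le>card B. c i \<ge> 0 \<and> v i \<in> N) \<and> (\<Sum>i\<le>card B. c i) = 1 \<and>
    (\<forall>b\<in>B. \<bar>\<Sum>i\<le>card B. c i * v i b\<bar> \<le> (e::real))"
proof -
  obtain k :: nat where k: "3 / e\<^sup>2 < real k" using reals_Archimedean2 by blast
  have "0 < 3 / e\<^sup>2" using e by simp
  then have "0 < real k" using k by linarith
  then have k0: "0 < k" by simp
  obtain v where v: "\<forall>i<k. v i \<in> N" "(\<Sum>b\<in>B. (\<Sum>i<k. v i b)\<^sup>2) \<le> 3 * real k"
    using greedy_small_sum[OF B unit half, of k] by blast
  have small: "\<bar>\<Sum>i<k. 1 / real k * v i b\<bar> \<le> e" if "b \<in> B" for b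
  proof -
    have "(\<Sum>i<k. v i b)\<^sup>2 \<le> (\<Sum>b\<in>B. (\<Sum>i<k. v i b)\<^sup>2)"
      using B that by (intro member_le_sum[of b B "\<lambda>b. (\<Sum>i<k. v i b)\<^sup>2"]) auto
    also have "\<dots> \<le> 3 * real k" by (rule v)
    also have "\<dots> \<le> (e * real k)\<^sup>2"
      using k e k0 by (simp add: field_simps power2_eq_square)
    finally have "\<bar>\<Sum>i<k. v i b\<bar> \<le> e * real k"
      using e by (simp add: abs_le_square_iff[symmetric])
    then have "\<bar>\<Sum>i<k. v i b\<bar> / real k \<le> e" using k0 by (simp add: field_simps)
    moreover have "(\<Sum>i<k. 1 / real k * v i b) = (\<Sum>i<k. v i b) / real k"
      by (simp add: sum_divide_distrib)
    ultimately show ?thesis by (simp add: abs_divide)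
  qed
  obtain J c where J: "J \<subseteq> {..<k}" "card J \<le> card B + 1" "\<forall>j\<in>J. c j \<ge> 0" "(\<Sum>j\<in>J. c j) = 1"
    "\<forall>b\<in>B. (\<Sum>j\<in>J. c j * v j b) = (\<Sum>j<k. 1 / real k * v j b)"
    using caratheodory_functions[OF B, of "{..<k}" "\<lambda>_. 1 / real k" v] k0 by auto
  have finJ: "finite J" using J(1) finite_subset by blast
  obtain h where h: "bij_betw h {..<card J} J"
    using finJ by (metis ex_bij_betw_nat_finite atLeast0LessThan)
  obtain u where u: "u \<in> N" using half[of "\<lambda>_. 0"] by (rule bexE)
  \<comment> \<open>Positions from \<open>card J\<close> on are padded with weight 0 and an
    arbitrary element of \<open>N\<close>, so that the index range is always
    \<open>{..card B}\<close>.\<close>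
  define c' where "c' i = (if i < card J then c (h i) else 0)" for i
  define v' where "v' i = (if i < card J then v (h i) else u)" for i
  have hJ: "h i \<in> J" if "i < card J" for i using h that by (auto simp: bij_betw_def)
  have sum: "(\<Sum>i\<le>card B. c' i * w i) = (\<Sum>j\<in>J. c j * w' j)"
    if "\<And>i. i < card J \<Longrightarrow> w i = w' (h i)" for w w'
  proof -
    have "(\<Sum>i\<le>card B. c' i * w i) = (\<Sum>i<card J. c (h i) * w' (h i))"
      using J(2) that by (intro sum.mono_neutral_cong_right) (auto simp: c'_def)
    also have "\<dots> = (\<Sum>j\<in>J. c j * w' j)"
      by (rule sum.reindex_bij_betw[OF h])
    finally show ?thesis .
  qed
  show ?thesis
  proof (intro exI conjI)
    show "\<forall>i\<le>card B. c' i \<ge> 0 \<and> v' i \<in> N"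
    proof (intro allI impI)
      fix i
      have "h i < k" if "i < card J" using hJ[OF that] J(1) by blast
      then show "c' i \<ge> 0 \<and> v' i \<in> N" using hJ[of i] J(3) v(1) u by (simp add: c'_def v'_def)
    qed
    show "(\<Sum>i\<le>card B. c' i) = 1"
      using sum[of "\<lambda>_. 1" "\<lambda>_. 1"] J by simp
    show "\<forall>b\<in>B. \<bar>\<Sum>i\<le>card B. c' i * v' i b\<bar> \<le> e"
    proof
      fix b assume b: "b \<in> B"
      have "(\<Sum>i\<le>card B. c' i * v' i b) = (\<Sum>j\<in>J. c j * v j b)"
        by (rule sum) (simp add: v'_def)
      then show "\<bar>\<Sum>i\<le>card B. c' i * v' i b\<bar> \<le> e" using J b small by simp
    qed
  qed
qed

lemma compact_common_subsequence:
  fixes f :: "'i \<Rightarrow> nat \<Rightarrow> 'c::metric_space"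
  assumes "finite I" "\<And>i. i \<in> I \<Longrightarrow> compact (K i)" "\<And>i n. i \<in> I \<Longrightarrow> f i n \<in> K i"
  shows "\<exists>r l. strict_mono (r :: nat \<Rightarrow> nat) \<and> (\<forall>i\<in>I. l i \<in> K i \<and> (f i \<circ> r) \<longlonglongrightarrow> l i)"
  using assms
proof (induction I rule: finite_induct)
  case empty
  show ?case by (intro exI[of _ id]) (auto simp: strict_mono_def)
next
  case (insert j I)
  have "\<exists>r l. strict_mono (r :: nat \<Rightarrow> nat) \<and> (\<forall>i\<in>I. l i \<in> K i \<and> (f i \<circ> r) \<longlonglongrightarrow> l i)"
  proof (rule insert.IH)
    show "compact (K i)" if "i \<in> I" for i using insert.prems(1)[of i] that by blast
    show "f i n \<in> K i" if "i \<in> I" for i n using insert.prems(2)[of i n] that by blast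
  qed
  then obtain r l where r: "strict_mono r" "\<forall>i\<in>I. l i \<in> K i \<and> (f i \<circ> r) \<longlonglongrightarrow> l i" by blast
  have "seq_compact (K j)" using insert.prems(1)[of j] compact_eq_seq_compact_metric by blast
  moreover have "\<forall>n. (f j \<circ> r) n \<in> K j" using insert.prems(2) by simp
  ultimately obtain z s where s: "z \<in> K j" "strict_mono s" "((f j \<circ> r) \<circ> s) \<longlonglongrightarrow> z"
    using seq_compactE by blast
  have lim: "(f i \<circ> (r \<circ> s)) \<longlonglongrightarrow> (l(j := z)) i \<and> (l(j := z)) i \<in> K i" if "i \<in> insert j I" for i
  proof (cases "i = j")
    case True
    then show ?thesis using s by (simp add: comp_assoc)
  next
    case False
    then have "i \<in> I" using that by simp
    then show ?thesis using r(2) False LIMSEQ_subseq_LIMSEQ[OF _ s(2), of "f i \<circ> r" "l i"]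
      by (simp add: comp_assoc)
  qed
  show ?case
  proof (intro exI conjI ballI)
    show "strict_mono (r \<circ> s)" using strict_mono_o[OF r(1) s(2)] .
    fix i assume i: "i \<in> insert j I"
    show "(l(j := z)) i \<in> K i" by (rule conjunct2[OF lim[OF i]])
    show "(f i \<circ> (r \<circ> s)) \<longlonglongrightarrow> (l(j := z)) i" by (rule conjunct1[OF lim[OF i]])
  qed
qed

section \<open>Minimal self-joinings\<close>

lemma LIMSEQ_if_dist_less_inverse:
  fixes u :: "nat \<Rightarrow> 'c::metric_space"
  assumes "\<And>k. dist (u k) z < 1 / real (Suc k)"
  shows "u \<longlonglongrightarrow> z"
  unfolding tendsto_dist_iff[of _ z]
proof (rule tendsto_sandwich[OF _ _ tendsto_const LIMSEQ_inverse_real_of_nat])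
  have "dist (u k) z \<le> inverse (real (Suc k))" for k
    using assms[of k] by (simp add: inverse_eq_divide)
  then show "\<forall>\<^sub>F k in sequentially. dist (u k) z \<le> inverse (real (Suc k))"
    by (intro always_eventually allI)
qed simp

lemma finite_common_positive:
  fixes P :: "'c \<Rightarrow> real \<Rightarrow> bool"
  assumes "finite A" "\<And>a. a \<in> A \<Longrightarrow> \<exists>d>0. P a d"
    and "\<And>a d d'. a \<in> A \<Longrightarrow> P a d \<Longrightarrow> 0 < d' \<Longrightarrow> d' \<le> d \<Longrightarrow> P a d'"
  shows "\<exists>d>0. \<forall>a\<in>A. P a d"
  using assms
proof (induction A rule: finite_induct)
  case empty
  show ?case by (intro exI[of _ 1]) simp
next
  case (insert x A)
  have "\<exists>d>0. \<forall>a\<in>A. P a d"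
  proof (rule insert.IH)
    show "\<exists>d>0. P a d" if "a \<in> A" for a using insert.prems(1)[of a] that by simp
    show "P a d'" if "a \<in> A" "P a d" "0 < d'" "d' \<le> d" for a d d'
      using insert.prems(2)[of a d d'] that by simp
  qed
  then obtain d where d: "d > 0" "\<forall>a\<in>A. P a d" by blast
  obtain d' where d': "d' > 0" "P x d'" using insert.prems(1)[of x] by blast
  have "P a (min d d')" if "a \<in> insert x A" for a
  proof (cases "a = x")
    case True
    then show ?thesis using insert.prems(2)[of x d' "min d d'"] d d' by simp
  next
    case False
    then show ?thesis using insert.prems(2)[of a d "min d d'"] d d' that by simp
  qed
  then show ?case using d d' by (intro exI[of _ "min d d'"]) simp
qed

text \<open>Countability allows the group to be enumerated, for exhaustion by finite sets and for a
  diagonal argument; \<open>2 \<le> n\<close> gives density of pair orbits.\<close>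

locale self_joining_system = topological_dynamical_system G X T + comm_group G
  for G :: "('g, 'm) monoid_scheme" (structure) and X :: "'x::metric_space set"
    and T :: "'g \<Rightarrow> 'x \<Rightarrow> 'x" +
  fixes n :: nat
  assumes sTMSJ: "strong_TMSJ n G X T" and two_le: "2 \<le> n"
    and countable_carrier: "countable (carrier G)"
begin

lemma infinite_space: "infinite X"
  using sTMSJ unfolding strong_TMSJ_def by blast

lemma T_closed [simp]: "g \<in> carrier G \<Longrightarrow> x \<in> X \<Longrightarrow> T g x \<in> X"
  using maps_to by blast

lemma T_inv: "g \<in> carrier G \<Longrightarrow> x \<in> X \<Longrightarrow> T (inv g) (T g x) = x"
  and T_inv': "g \<in> carrier G \<Longrightarrow> x \<in> X \<Longrightarrow> T g (T (inv g) x) = x"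
  by (simp_all add: act_mult act_one)

lemma T_commute: "g \<in> carrier G \<Longrightarrow> h \<in> carrier G \<Longrightarrow> x \<in> X \<Longrightarrow> T g (T h x) = T h (T g x)"
  by (simp add: act_mult m_comm)

lemma T_tendsto:
  assumes "g \<in> carrier G" "\<And>m. u m \<in> X" "u \<longlonglongrightarrow> z" "z \<in> X"
  shows "(\<lambda>m. T g (u m)) \<longlonglongrightarrow> T g z"
  using continuous_on_tendsto_compose[OF continuous[OF assms(1)] assms(3,4)] assms(2) by simp

lemma group_center_eq: "group_center G = carrier G"
  unfolding group_center_def by (auto simp: m_comm)

lemma joint_orbit_dense:
  assumes k: "1 \<le> k" "k \<le> n" and w: "\<And>i. i < k \<Longrightarrow> w i \<in> X"
    and orb: "\<And>i j g. i < k \<Longrightarrow> j < k \<Longrightarrow> i \<noteq> j \<Longrightarrow> g \<in> carrier G \<Longrightarrow> w j \<noteq> T g (w i)"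
    and z: "\<And>i. i < k \<Longrightarrow> z i \<in> X" and d: "d > 0"
  shows "\<exists>g\<in>carrier G. \<forall>i<k. dist (T g (w i)) (z i) < d"
proof -
  let ?P = "product_topology (\<lambda>_. top_of_set X) {..<k}"
  let ?O = "(\<lambda>g. \<lambda>i\<in>{..<k}. T g (w i)) ` carrier G"
  have "inj_on w {..<k}"
  proof (rule inj_onI)
    fix i j assume "i \<in> {..<k}" "j \<in> {..<k}" "w i = w j"
    then show "i = j" using orb[of i j \<one>] w act_one[of "w i"] by force
  qed
  moreover have "(\<lambda>z. T z (w i)) ` group_center G \<noteq> (\<lambda>z. T z (w j)) ` group_center G"
    if "i < k" "j < k" "i \<noteq> j" for i j
  proof
    assume eq: "(\<lambda>z. T z (w i)) ` group_center G = (\<lambda>z. T z (w j)) ` group_center G"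
    have "w j \<in> (\<lambda>z. T z (w j)) ` group_center G"
      unfolding group_center_eq using act_one[OF w[OF that(2)]] by (metis image_eqI one_closed)
    then show False using eq orb[OF that] unfolding group_center_eq by auto
  qed
  moreover have "w \<in> {..<k} \<rightarrow> X" using w by auto
  ultimately have "?P closure_of ?O = {..<k} \<rightarrow>\<^sub>E X"
    using sTMSJ k unfolding strong_TMSJ_def by blast
  moreover have "restrict z {..<k} \<in> {..<k} \<rightarrow>\<^sub>E X" using z by auto
  ultimately have "restrict z {..<k} \<in> ?P closure_of ?O" by simp
  moreover define U where "U = PiE {..<k} (\<lambda>i. X \<inter> ball (z i) d)"
  have "openin ?P U"
    unfolding U_def by (intro openin_PiE_gen[THEN iffD2] disjI2) (auto simp: openin_open_Int)
  moreover have "restrict z {..<k} \<in> U" using z d by (auto simp: U_def)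
  ultimately have "\<exists>y\<in>?O. y \<in> U" unfolding in_closure_of by blast
  then obtain g where g: "g \<in> carrier G" "(\<lambda>i\<in>{..<k}. T g (w i)) \<in> U" by blast
  then have "\<forall>i<k. dist (T g (w i)) (z i) < d"
    by (auto simp: U_def PiE_iff dist_commute)
  then show ?thesis using g by blast
qed

lemma orbit_dense:
  assumes "x \<in> X" "z \<in> X" "d > 0"
  shows "\<exists>g\<in>carrier G. dist (T g x) z < d"
  using joint_orbit_dense[of 1 "\<lambda>_. x" "\<lambda>_. z" d] assms two_le by auto

lemma orbit_sequence:
  assumes "x \<in> X" "z \<in> X"
  obtains a where "\<And>m. a m \<in> carrier G" "(\<lambda>m. T (a m) x) \<longlonglongrightarrow> z"
proof -
  have "\<forall>m. \<exists>g\<in>carrier G. dist (T g x) z < 1 / real (Suc m)"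
    using orbit_dense[OF assms] by simp
  then obtain a where a: "\<And>m. a m \<in> carrier G" "\<And>m. dist (T (a m) x) z < 1 / real (Suc m)"
    by metis
  have "(\<lambda>m. T (a m) x) \<longlonglongrightarrow> z"
    using a(2) by (rule LIMSEQ_if_dist_less_inverse)
  then show ?thesis using that a(1) by blast
qed

lemma pair_orbit_dense:
  assumes "x \<in> X" "y \<in> X" "\<And>g. g \<in> carrier G \<Longrightarrow> y \<noteq> T g x" "a \<in> X" "b \<in> X" "d > 0"
  shows "\<exists>g\<in>carrier G. dist (T g x) a < d \<and> dist (T g y) b < d"
proof -
  have "x \<noteq> T g y" if "g \<in> carrier G" for g
    using assms(3)[of "inv g"] T_inv[of g y] that assms(2) by auto
  then have "\<exists>g\<in>carrier G. \<forall>i<2. dist (T g ((\<lambda>i::nat. if i = 0 then x else y) i))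
      ((\<lambda>i::nat. if i = 0 then a else b) i) < d"
    using assms two_le by (intro joint_orbit_dense) (auto split: if_splits)
  then obtain g where g: "g \<in> carrier G"
    "\<And>i. i < 2 \<Longrightarrow> dist (T g (if i = (0::nat) then x else y)) (if i = 0 then a else b) < d" by blast
  show ?thesis using g(1) g(2)[of 0] g(2)[of 1] by auto
qed

lemma pair_orbit_far:
  assumes "x \<in> X" "y \<in> X" "\<And>g. g \<in> carrier G \<Longrightarrow> y \<noteq> T g x" "a \<in> X" "b \<in> X" "dist a b > e"
  shows "\<exists>g\<in>carrier G. dist (T g x) (T g y) > e"
proof -
  obtain g where g: "g \<in> carrier G" "dist (T g x) a < (dist a b - e) / 2"
    "dist (T g y) b < (dist a b - e) / 2"
    using pair_orbit_dense[OF assms(1-5), of "(dist a b - e) / 2"] assms(6) by auto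
  have "dist a b \<le> dist (T g x) a + dist (T g x) (T g y) + dist (T g y) b"
    by (smt (verit) dist_commute dist_triangle)
  then have "dist (T g x) (T g y) > e" using g by (simp add: field_simps)
  then show ?thesis using g(1) by blast
qed

text \<open>Since the group is abelian, the hypothesis compares \<open>T g\<close> and
  \<open>T h\<close> at every point of the orbit of \<open>x\<close>; that orbit is dense and the
  bound passes to limits.\<close>

lemma close_on_orbit_imp_close:
  assumes "x \<in> X" "g \<in> carrier G" "h \<in> carrier G" "z \<in> X"
    and "\<And>k. k \<in> carrier G \<Longrightarrow> dist (T k (T g x)) (T k (T h x)) \<le> e"
  shows "dist (T g z) (T h z) \<le> e"
proof -
  obtain a where a: "\<And>m. a m \<in> carrier G" "(\<lambda>m. T (a m) x) \<longlonglongrightarrow> z"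
    using orbit_sequence[OF assms(1,4)] by blast
  have "(\<lambda>m. dist (T g (T (a m) x)) (T h (T (a m) x))) \<longlonglongrightarrow> dist (T g z) (T h z)"
    using a assms by (intro tendsto_dist T_tendsto) auto
  moreover have "dist (T g (T (a m) x)) (T h (T (a m) x)) \<le> e" for m
    using assms(5)[OF a(1), of m] T_commute[OF assms(2) a(1) assms(1)] T_commute[OF assms(3) a(1) assms(1)]
    by simp
  ultimately show ?thesis by (intro LIMSEQ_le_const2) auto
qed

lemma infinite_orbit:
  assumes "x \<in> X" shows "infinite ((\<lambda>g. T g x) ` carrier G)"
proof
  assume fin: "finite ((\<lambda>g. T g x) ` carrier G)"
  have "z \<in> (\<lambda>g. T g x) ` carrier G" if "z \<in> X" for z
  proof -
    have "\<forall>e>0. \<exists>y\<in>(\<lambda>g. T g x) ` carrier G. dist y z < e"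
      using orbit_dense[OF assms that] by blast
    then have "z \<in> closure ((\<lambda>g. T g x) ` carrier G)" by (simp only: closure_approachable)
    then show ?thesis using fin by (simp add: finite_imp_closed)
  qed
  then have "X \<subseteq> (\<lambda>g. T g x) ` carrier G" by blast
  then show False using fin infinite_space finite_subset by blast
qed

text \<open>Elements that agree at one point agree everywhere, by the case of distance 0 in
  \<open>close_on_orbit_imp_close\<close>. So elements with distinct images of \<open>x\<close> have
  distinct images of every point, and compactness gives a uniform gap.\<close>

lemma separated_translations:
  fixes m :: nat
  shows "\<exists>a d. 0 < d \<and> (\<forall>i<m. a i \<in> carrier G) \<and>
    (\<forall>i<m. \<forall>j<m. i \<noteq> j \<longrightarrow> (\<forall>y\<in>X. d \<le> dist (T (a i) y) (T (a j) y)))"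
proof -
  obtain x where x: "x \<in> X" using infinite_space by (metis finite.emptyI all_not_in_conv)
  obtain u :: "nat \<Rightarrow> 'x" where u: "inj u" "range u \<subseteq> (\<lambda>g. T g x) ` carrier G"
    using infinite_countable_subset[OF infinite_orbit[OF x]] by blast
  have "\<forall>i. \<exists>g\<in>carrier G. u i = T g x" using u(2) by blast
  then obtain a where a: "\<And>i. a i \<in> carrier G" "\<And>i. u i = T (a i) x" by metis
  have ne: "T (a i) y \<noteq> T (a j) y" if "i \<noteq> j" "y \<in> X" for i j y
  proof
    assume eq: "T (a i) y = T (a j) y"
    have "dist (T (a i) x) (T (a j) x) \<le> 0"
      using that a eq x by (intro close_on_orbit_imp_close[of y]) auto
    then have "u i = u j" using a(2) by simp
    then show False using u(1) that(1) by (simp add: inj_eq)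
  qed
  have "\<exists>d>0. \<forall>p\<in>{p \<in> {..<m} \<times> {..<m}. fst p \<noteq> snd p}.
      \<forall>y\<in>X. dist (T (a (fst p)) y) (T (a (snd p)) y) \<ge> d"
  proof (rule finite_common_positive)
    show "finite {p \<in> {..<m} \<times> {..<m}. fst p \<noteq> snd p}" by simp
    fix p assume p: "p \<in> {p \<in> {..<m} \<times> {..<m}. fst p \<noteq> snd p}"
    have "continuous_on X (\<lambda>y. dist (T (a (fst p)) y) (T (a (snd p)) y))"
      using continuous a(1) by (intro continuous_on_dist) auto
    from continuous_attains_inf[OF compact_space _ this] x
    obtain y where y: "y \<in> X" "\<forall>z\<in>X. dist (T (a (fst p)) y) (T (a (snd p)) y) \<le>
        dist (T (a (fst p)) z) (T (a (snd p)) z)" by blast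
    then show "\<exists>d>0. \<forall>y\<in>X. dist (T (a (fst p)) y) (T (a (snd p)) y) \<ge> d"
      using ne[of "fst p" "snd p" y] p by (intro exI[of _ "dist (T (a (fst p)) y) (T (a (snd p)) y)"]) auto
  qed force
  then obtain d where d: "d > 0" "\<forall>p\<in>{p \<in> {..<m} \<times> {..<m}. fst p \<noteq> snd p}.
      \<forall>y\<in>X. dist (T (a (fst p)) y) (T (a (snd p)) y) \<ge> d" by blast
  have "d \<le> dist (T (a i) y) (T (a j) y)" if "i < m" "j < m" "i \<noteq> j" "y \<in> X" for i j y
    using d(2)[THEN bspec, of "(i, j)"] that by simp
  then show ?thesis using a(1) d(1) by (intro exI[of _ a] exI[of _ d]) simp
qed

lemma uniformly_close:
  assumes "finite F" "F \<subseteq> carrier G" "e > 0"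
  shows "\<exists>d>0. \<forall>g\<in>F. \<forall>x\<in>X. \<forall>y\<in>X. dist x y < d \<longrightarrow> dist (T g x) (T g y) \<le> e"
proof (rule finite_common_positive[OF assms(1)])
  fix g assume "g \<in> F"
  then have "uniformly_continuous_on X (T g)"
    using assms continuous compact_space by (intro compact_uniformly_continuous) auto
  then obtain d where "d > 0" "\<forall>x\<in>X. \<forall>x'\<in>X. dist x' x < d \<longrightarrow> dist (T g x') (T g x) < e"
    using assms(3) unfolding uniformly_continuous_on_def by blast
  then show "\<exists>d>0. \<forall>x\<in>X. \<forall>y\<in>X. dist x y < d \<longrightarrow> dist (T g x) (T g y) \<le> e"
    by (intro exI[of _ d]) (auto intro: less_imp_le)
qed force

text \<open>A group element moving every point by very little would allow a nested choice of group elements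
  whose uniform limit is not given by any group element; then a point and its image under the limit map
  lie in different orbits and yet stay close forever.\<close>

lemma small_displacement_trivial:
  "\<exists>e>0. \<forall>h\<in>carrier G. (\<forall>z\<in>X. dist z (T h z) \<le> e) \<longrightarrow> (\<forall>z\<in>X. T h z = z)"
proof (rule ccontr)
  assume "\<not> ?thesis"
  then have small: "\<exists>h\<in>carrier G. (\<forall>z\<in>X. dist z (T h z) \<le> e) \<and> (\<exists>z\<in>X. T h z \<noteq> z)"
    if "e > 0" for e :: real
    using that by blast
  obtain a where a: "a \<in> X" using infinite_space by (metis finite.emptyI all_not_in_conv)
  obtain b where b: "b \<in> X" "a \<noteq> b"
    using infinite_space by (metis finite.simps singletonI subsetI subset_singletonD)
  \<comment> \<open>The limit pair will always stay within \<open>r0\<close>, whereas a pair from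
    different orbits comes close to \<open>(a, b)\<close> and is then further apart than
    \<open>r0\<close>.\<close>
  define r0 where "r0 = dist a b / 2"
  have r0: "r0 > 0" using b by (simp add: r0_def)
  define enum where "enum = from_nat_into (carrier G)"
  have enum: "\<exists>m. enum m = g" if "g \<in> carrier G" for g
    using from_nat_into_surj[OF countable_carrier that] by (simp add: enum_def)
  define near where "near k k' r \<longleftrightarrow> (\<forall>z\<in>X. dist (T k z) (T k' z) \<le> r)" for k k' and r :: real
  \<comment> \<open>A state is a group element with a radius, and the eventual limit stays within
    the radius of the element. An element \<open>enum m\<close> that is not so close is thereby
    excluded as the limit.\<close>
  define step where "step m p q \<longleftrightarrow> near (fst p) (fst q) (snd p / 2) \<and> snd q \<le> snd p / 2 \<and>
      \<not> near (fst q) (enum m) (snd q)" for m and p q :: "'g \<times> real"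
  have step: "\<exists>q. (fst q \<in> carrier G \<and> snd q > 0) \<and> step m p q"
    if p: "fst p \<in> carrier G \<and> snd p > 0" for m p
  proof -
    obtain h z0 where h: "h \<in> carrier G" "\<And>z. z \<in> X \<Longrightarrow> dist z (T h z) \<le> snd p / 2"
      "z0 \<in> X" "T h z0 \<noteq> z0"
      using small[of "snd p / 2"] p by auto
    \<comment> \<open>\<open>fst p\<close> and \<open>h \<otimes> fst p\<close> act differently at
      \<open>z1\<close>, so at least one of them differs from \<open>enum m\<close> there.\<close>
    define z1 where "z1 = T (inv (fst p)) z0"
    have z1: "z1 \<in> X" "T (fst p) z1 = z0" using h p by (simp_all add: z1_def T_inv')
    have move: "T (h \<otimes> fst p) z = T h (T (fst p) z)" if "z \<in> X" for z
      using that h p by (simp add: act_mult)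
    have near': "near (fst p) (h \<otimes> fst p) (snd p / 2)"
      using h p by (auto simp: near_def move)
    have "\<exists>k\<in>carrier G. near (fst p) k (snd p / 2) \<and> T k z1 \<noteq> T (enum m) z1"
    proof (cases "T (fst p) z1 = T (enum m) z1")
      case True
      then have "T (h \<otimes> fst p) z1 \<noteq> T (enum m) z1" using h z1 move[of z1] by auto
      then show ?thesis using near' h p by (intro bexI[of _ "h \<otimes> fst p"]) auto
    next
      case False
      then show ?thesis using p by (intro bexI[of _ "fst p"]) (auto simp: near_def)
    qed
    then obtain k where k: "k \<in> carrier G" "near (fst p) k (snd p / 2)" "T k z1 \<noteq> T (enum m) z1" by blast
    define r where "r = min (snd p / 2) (dist (T k z1) (T (enum m) z1) / 2)"
    have r: "r > 0" "r \<le> snd p / 2" "r < dist (T k z1) (T (enum m) z1)"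
      using k p by (auto simp: r_def min_def)
    then have "\<not> near k (enum m) r" using z1 by (auto simp: near_def not_le)
    then show ?thesis using k r by (intro exI[of _ "(k, r)"]) (auto simp: step_def)
  qed
  have "\<exists>q. \<forall>m. (fst (q m) \<in> carrier G \<and> snd (q m) > 0 \<and> (m = 0 \<longrightarrow> q m = (\<one>, r0))) \<and>
      step m (q m) (q (Suc m))"
  proof (rule dependent_nat_choice)
    show "\<exists>p. fst p \<in> carrier G \<and> snd p > 0 \<and> ((0::nat) = 0 \<longrightarrow> p = (\<one>, r0))"
      by (intro exI[of _ "(\<one>, r0)"]) (simp add: r0)
    show "\<exists>q. (fst q \<in> carrier G \<and> snd q > 0 \<and> (Suc m = 0 \<longrightarrow> q = (\<one>, r0))) \<and> step m p q"
      if "fst p \<in> carrier G \<and> snd p > 0 \<and> (m = 0 \<longrightarrow> p = (\<one>, r0))" for p m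
      using step[of p m] that by simp
  qed
  then obtain q where q: "\<And>m. fst (q m) \<in> carrier G \<and> snd (q m) > 0 \<and> (m = 0 \<longrightarrow> q m = (\<one>, r0))"
    "\<And>m. step m (q m) (q (Suc m))"
    by blast
  define k where "k m = fst (q m)" for m
  define r where "r m = snd (q m)" for m
  have k: "k m \<in> carrier G" and r: "r m > 0" for m using q(1) by (auto simp: k_def r_def)
  have k0: "k 0 = \<one>" "r 0 = r0" using q(1)[of 0] by (auto simp: k_def r_def)
  have kS: "near (k m) (k (Suc m)) (r m / 2)" "r (Suc m) \<le> r m / 2"
    "\<not> near (k (Suc m)) (enum m) (r (Suc m))" for m
    using q(2)[of m] by (auto simp: step_def k_def r_def)
  \<comment> \<open>Each move is at most half the radius, hence at most the following drop of the
    radius, and the bounds telescope.\<close>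
  have dist_le: "near (k m) (k (m + j)) (r m - r (m + j))" for m j
  proof (induction j)
    case 0
    then show ?case by (simp add: near_def)
  next
    case (Suc j)
    show ?case unfolding near_def
    proof
      fix z assume z: "z \<in> X"
      have "dist (T (k m) z) (T (k (m + Suc j)) z) \<le>
          dist (T (k m) z) (T (k (m + j)) z) + dist (T (k (m + j)) z) (T (k (Suc (m + j))) z)"
        by (simp add: dist_triangle)
      also have "\<dots> \<le> (r m - r (m + j)) + r (m + j) / 2"
        using Suc kS(1)[of "m + j"] z by (intro add_mono) (auto simp: near_def)
      also have "\<dots> \<le> r m - r (m + Suc j)" using kS(2)[of "m + j"] by (simp add: field_simps)
      finally show "dist (T (k m) z) (T (k (m + Suc j)) z) \<le> r m - r (m + Suc j)" .
    qed
  qed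
  have cl: "dist (T (k m) z) (T (k m') z) \<le> r m" if "m \<le> m'" "z \<in> X" for m m' z
  proof -
    have "near (k m) (k m') (r m - r m')" using dist_le[of m "m' - m"] that(1) by simp
    then have "dist (T (k m) z) (T (k m') z) \<le> r m - r m'" using that(2) by (simp add: near_def)
    then show ?thesis using r[of m'] by linarith
  qed
  obtain y s where y: "y \<in> X" "strict_mono s" "((\<lambda>m. T (k m) a) \<circ> s) \<longlonglongrightarrow> y"
    using compact_space k a unfolding compact_eq_seq_compact_metric
    by (metis (no_types, lifting) seq_compactE T_closed)
  have lim: "dist (T g (T (k m) a)) (T g y) \<le> r m" if g: "g \<in> carrier G" for g m
  proof (rule LIMSEQ_le_const2)
    show "(\<lambda>j. dist (T g (T (k m) a)) (T g (T (k (s j)) a))) \<longlonglongrightarrow> dist (T g (T (k m) a)) (T g y)"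
      using y g k a by (intro tendsto_dist tendsto_const T_tendsto) (auto simp: comp_def)
    have "dist (T g (T (k m) a)) (T g (T (k (s j)) a)) \<le> r m" if "m \<le> j" for j
      using cl[of m "s j" "T g a"] that seq_suble[OF y(2), of j] g k a
        T_commute[OF g k a, of m] T_commute[OF g k a, of "s j"] by simp
    then show "\<exists>N. \<forall>j\<ge>N. dist (T g (T (k m) a)) (T g (T (k (s j)) a)) \<le> r m" by blast
  qed
  have "y \<noteq> T g a" if g: "g \<in> carrier G" for g
  proof
    assume yg: "y = T g a"
    obtain m where m: "enum m = g" using enum[OF g] by blast
    have "dist (T (k (Suc m)) z) (T g z) \<le> r (Suc m)" if "z \<in> X" for z
      using lim[of _ "Suc m"] yg that k g a by (intro close_on_orbit_imp_close[of a]) auto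
    then show False using kS(3)[of m] m by (auto simp: near_def)
  qed
  then obtain g where g: "g \<in> carrier G" "dist (T g a) (T g y) > r0"
    using pair_orbit_far[of a y a b r0] a b y r0 by (auto simp: r0_def)
  then show False using lim[OF g(1), of 0] k0 a act_one[of a] by simp
qed

section \<open>Thick sets of times\<close>

definition thick :: "'g set \<Rightarrow> bool" where
  "thick A \<longleftrightarrow> (\<forall>F. finite F \<longrightarrow> F \<subseteq> carrier G \<longrightarrow> (\<exists>g\<in>carrier G. \<forall>f\<in>F. f \<otimes> g \<in> A))"

lemma exhaustion:
  "\<exists>F :: nat \<Rightarrow> 'g set. (\<forall>m. finite (F m) \<and> F m \<subseteq> carrier G) \<and>
     (\<forall>g\<in>carrier G. \<exists>m0. \<forall>m\<ge>m0. g \<in> F m)"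
proof (intro exI[of _ "\<lambda>m. from_nat_into (carrier G) ` {..m}"] conjI allI ballI)
  show "from_nat_into (carrier G) ` {..m} \<subseteq> carrier G" for m
    using from_nat_into[of "carrier G"] by blast
  show "\<exists>m0. \<forall>m\<ge>m0. g \<in> from_nat_into (carrier G) ` {..m}" if "g \<in> carrier G" for g
    using from_nat_into_surj[OF countable_carrier that] by auto
qed simp

text \<open>If \<open>a m\<close> translates \<open>F m\<close> into \<open>A\<close> and
  \<open>x'\<close> is a limit point of \<open>T (a m) x\<close>, then \<open>x'\<close> and
  \<open>T h x'\<close> are close at all times. Density of the orbit of \<open>x'\<close> spreads
  this to every \<open>z\<close>.\<close>

lemma close_on_thick_same_orbit:
  assumes A: "thick A" and x: "x \<in> X" and h: "h \<in> carrier G" and z: "z \<in> X"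
    and cl: "\<And>g. g \<in> A \<Longrightarrow> g \<in> carrier G \<Longrightarrow> dist (T g x) (T g (T h x)) \<le> e"
  shows "dist z (T h z) \<le> e"
proof -
  obtain F :: "nat \<Rightarrow> 'g set" where "(\<forall>m. finite (F m) \<and> F m \<subseteq> carrier G) \<and>
      (\<forall>g\<in>carrier G. \<exists>m0. \<forall>m\<ge>m0. g \<in> F m)"
    using exhaustion by (rule exE)
  then have F: "\<And>m. finite (F m)" "\<And>m. F m \<subseteq> carrier G"
    "\<And>g. g \<in> carrier G \<Longrightarrow> \<exists>m0. \<forall>m\<ge>m0. g \<in> F m"
    by simp_all
  have "\<forall>m. \<exists>g\<in>carrier G. \<forall>f\<in>F m. f \<otimes> g \<in> A" using A F(1,2) unfolding thick_def by blast
  then obtain a where a: "\<And>m. a m \<in> carrier G" "\<And>m f. f \<in> F m \<Longrightarrow> f \<otimes> a m \<in> A" by metis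
  obtain x' s where s: "x' \<in> X" "strict_mono s" "((\<lambda>m. T (a m) x) \<circ> s) \<longlonglongrightarrow> x'"
    using compact_space a x unfolding compact_eq_seq_compact_metric
    by (metis (no_types, lifting) seq_compactE T_closed)
  have "dist (T g (T \<one> x')) (T g (T h x')) \<le> e" if g: "g \<in> carrier G" for g
  proof (rule LIMSEQ_le_const2)
    show "(\<lambda>j. dist (T g (T \<one> (T (a (s j)) x))) (T g (T h (T (a (s j)) x))))
        \<longlonglongrightarrow> dist (T g (T \<one> x')) (T g (T h x'))"
      using s g h a x by (intro tendsto_dist T_tendsto) (auto simp: comp_def)
    obtain m0 where m0: "\<forall>m\<ge>m0. g \<in> F m" using F(3)[OF g] by blast
    have "dist (T g (T \<one> (T (a (s j)) x))) (T g (T h (T (a (s j)) x))) \<le> e" if "m0 \<le> j" for j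
    proof -
      have "g \<in> F (s j)" using m0 that seq_suble[OF s(2), of j] by simp
      then have "dist (T (g \<otimes> a (s j)) x) (T (g \<otimes> a (s j)) (T h x)) \<le> e"
        using a g by (intro cl) auto
      then show ?thesis
        using a g h x by (simp add: act_mult[symmetric] act_one T_commute[of h])
    qed
    then show "\<exists>N. \<forall>j\<ge>N. dist (T g (T \<one> (T (a (s j)) x))) (T g (T h (T (a (s j)) x))) \<le> e" by blast
  qed
  then have "dist (T \<one> z) (T h z) \<le> e"
    using s h z by (intro close_on_orbit_imp_close[of x']) auto
  then show ?thesis using z by (simp add: act_one)
qed

lemma thick_carrier: "thick (carrier G)"
  unfolding thick_def by (auto intro!: bexI[of _ \<one>])

end

text \<open>\<open>e\<close> is below the displacement that forces an element to act trivially, and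
  no point is within \<open>e\<close> of two of the points \<open>T (a i) y\<close>. The number
  \<open>m\<close> of translations must exceed the number of pairs treated later.\<close>

locale expansive_scale = self_joining_system G X T n
  for G :: "('g, 'm) monoid_scheme" (structure) and X :: "'x::metric_space set"
    and T :: "'g \<Rightarrow> 'x \<Rightarrow> 'x" and n :: nat +
  fixes e :: real and a :: "nat \<Rightarrow> 'g" and m :: nat
  assumes e: "e > 0"
    and rigid: "\<And>h z. h \<in> carrier G \<Longrightarrow> (\<And>z. z \<in> X \<Longrightarrow> dist z (T h z) \<le> e) \<Longrightarrow> z \<in> X \<Longrightarrow> T h z = z"
    and a: "\<And>i. i < m \<Longrightarrow> a i \<in> carrier G" and m: "2 \<le> m"
    and separated: "\<And>i j y. i < m \<Longrightarrow> j < m \<Longrightarrow> i \<noteq> j \<Longrightarrow> y \<in> X \<Longrightarrow>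
      2 * e < dist (T (a i) y) (T (a j) y)"
begin

text \<open>Otherwise \<open>h\<close> would displace every point by at most \<open>e\<close>, hence
  act trivially, and the two points would coincide.\<close>

lemma thick_imp_different_orbits:
  assumes "thick A" "x \<in> X" "y \<in> X" "x \<noteq> y"
    and "\<And>g. g \<in> A \<Longrightarrow> g \<in> carrier G \<Longrightarrow> dist (T g x) (T g y) \<le> e" and h: "h \<in> carrier G"
  shows "y \<noteq> T h x"
proof
  assume "y = T h x"
  then have "dist z (T h z) \<le> e" if "z \<in> X" for z
    using close_on_thick_same_orbit[OF assms(1,2) h that, of e] assms(5) by simp
  then have "T h x = x" using rigid h assms(2) by blast
  then show False using assms(4) \<open>y = T h x\<close> by simp
qed

text \<open>Distinct points that are always close lie in different orbits, so their pair orbit is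
  dense; yet it cannot approach \<open>(T (a 0) x, T (a 1) x)\<close>.\<close>

lemma expansive:
  assumes "x \<in> X" "y \<in> X" "\<And>g. g \<in> carrier G \<Longrightarrow> dist (T g x) (T g y) \<le> e"
  shows "x = y"
proof (rule ccontr)
  assume ne: "x \<noteq> y"
  have "y \<noteq> T h x" if "h \<in> carrier G" for h
    using thick_imp_different_orbits[OF thick_carrier assms(1,2) ne assms(3) that] by simp
  moreover have "dist (T (a 0) x) (T (a 1) x) > e"
    using separated[of 0 1 x] m e assms(1) by simp
  ultimately obtain g where "g \<in> carrier G" "dist (T g x) (T g y) > e"
    using pair_orbit_far[of x y "T (a 0) x" "T (a 1) x" e] assms a m by force
  then show False using assms(3) by force
qed

text \<open>Compactness: counterexamples for an exhausting sequence of finite sets would have a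
  limit pair that is always \<open>e\<close>-close but at distance at least
  \<open>d\<close>.\<close>

lemma finite_expansive:
  assumes "d > 0"
  shows "\<exists>F. finite F \<and> F \<subseteq> carrier G \<and>
    (\<forall>x\<in>X. \<forall>y\<in>X. (\<forall>g\<in>F. dist (T g x) (T g y) \<le> e) \<longrightarrow> dist x y < d)"
proof (rule ccontr)
  assume neg: "\<not> ?thesis"
  obtain F :: "nat \<Rightarrow> 'g set" where "(\<forall>m. finite (F m) \<and> F m \<subseteq> carrier G) \<and>
      (\<forall>g\<in>carrier G. \<exists>m0. \<forall>m\<ge>m0. g \<in> F m)"
    using exhaustion by (rule exE)
  then have F: "\<And>m. finite (F m)" "\<And>m. F m \<subseteq> carrier G"
    "\<And>g. g \<in> carrier G \<Longrightarrow> \<exists>m0. \<forall>m\<ge>m0. g \<in> F m"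
    by simp_all
  have "\<exists>p. p \<in> X \<times> X \<and> (\<forall>g\<in>F m. dist (T g (fst p)) (T g (snd p)) \<le> e) \<and> d \<le> dist (fst p) (snd p)" for m
  proof -
    have "\<not> (\<forall>x\<in>X. \<forall>y\<in>X. (\<forall>g\<in>F m. dist (T g x) (T g y) \<le> e) \<longrightarrow> dist x y < d)"
    proof
      assume "\<forall>x\<in>X. \<forall>y\<in>X. (\<forall>g\<in>F m. dist (T g x) (T g y) \<le> e) \<longrightarrow> dist x y < d"
      then have "finite (F m) \<and> F m \<subseteq> carrier G \<and>
          (\<forall>x\<in>X. \<forall>y\<in>X. (\<forall>g\<in>F m. dist (T g x) (T g y) \<le> e) \<longrightarrow> dist x y < d)"
        using F(1,2) by (intro conjI)
      then have "\<exists>F. finite F \<and> F \<subseteq> carrier G \<and>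
          (\<forall>x\<in>X. \<forall>y\<in>X. (\<forall>g\<in>F. dist (T g x) (T g y) \<le> e) \<longrightarrow> dist x y < d)" by (rule exI)
      with neg show False by (rule notE)
    qed
    then obtain x y where "x \<in> X" "y \<in> X" "\<forall>g\<in>F m. dist (T g x) (T g y) \<le> e" "\<not> dist x y < d"
      by blast
    then show ?thesis by (intro exI[of _ "(x, y)"]) (simp add: not_less)
  qed
  then obtain p where p: "\<And>m. p m \<in> X \<times> X"
    "\<And>m g. g \<in> F m \<Longrightarrow> dist (T g (fst (p m))) (T g (snd (p m))) \<le> e"
    "\<And>m. d \<le> dist (fst (p m)) (snd (p m))" by metis
  have "seq_compact (X \<times> X)"
    using compact_Times[OF compact_space compact_space] by (simp add: compact_eq_seq_compact_metric)
  then obtain l s where l: "l \<in> X \<times> X" "strict_mono s" "(p \<circ> s) \<longlonglongrightarrow> l"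
    using p(1) by (metis seq_compactE)
  have l1: "(\<lambda>j. fst (p (s j))) \<longlonglongrightarrow> fst l" and l2: "(\<lambda>j. snd (p (s j))) \<longlonglongrightarrow> snd l"
    using tendsto_fst[OF l(3)] tendsto_snd[OF l(3)] by (simp_all add: comp_def)
  have X: "fst (p j) \<in> X" "snd (p j) \<in> X" "fst l \<in> X" "snd l \<in> X" for j
    using p(1)[of j] l(1) by auto
  have "dist (T g (fst l)) (T g (snd l)) \<le> e" if g: "g \<in> carrier G" for g
  proof (rule LIMSEQ_le_const2)
    show "(\<lambda>j. dist (T g (fst (p (s j)))) (T g (snd (p (s j)))))
        \<longlonglongrightarrow> dist (T g (fst l)) (T g (snd l))"
      using g X l1 l2 by (intro tendsto_dist T_tendsto) auto
    obtain m0 where m0: "\<forall>m\<ge>m0. g \<in> F m" using F(3)[OF g] by blast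
    then have "dist (T g (fst (p (s j)))) (T g (snd (p (s j)))) \<le> e" if "m0 \<le> j" for j
      using p(2) that seq_suble[OF l(2), of j] by simp
    then show "\<exists>N. \<forall>j\<ge>N. dist (T g (fst (p (s j)))) (T g (snd (p (s j)))) \<le> e" by blast
  qed
  then have "fst l = snd l" using expansive X by blast
  moreover have "d \<le> dist (fst l) (snd l)"
    using p(3) by (intro LIMSEQ_le_const[OF tendsto_dist[OF l1 l2]]) auto
  ultimately show False using assms by simp
qed

end

section \<open>Supporting half-spaces\<close>

lemma L2_set_square: "(L2_set f A)\<^sup>2 = (\<Sum>i\<in>A. (f i)\<^sup>2)"
  by (simp add: L2_set_def sum_nonneg)

text \<open>Take \<open>u\<close> opposite to \<open>S\<close> and \<open>c\<close> at most the
  reciprocal of the norm of \<open>S\<close>; the further bound 1/2 ensures \<open>c < 1\<close>. If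
  \<open>S\<close> vanishes on \<open>B\<close>, any unit vector serves.\<close>

lemma unit_direction_for_half_space:
  fixes S :: "'b \<Rightarrow> real"
  assumes "finite B" "B \<noteq> {}"
  obtains u c where "L2_set u B = 1" "0 < c" "c < 1"
    "\<And>v. - c \<le> (\<Sum>b\<in>B. v b * u b) \<Longrightarrow> (\<Sum>b\<in>B. v b * S b) \<le> (1::real)"
proof (cases "L2_set S B = 0")
  case True
  then have S: "\<forall>b\<in>B. S b = 0" using assms by (simp add: L2_set_eq_0_iff)
  obtain b0 where b0: "b0 \<in> B" using assms by blast
  define u :: "'b \<Rightarrow> real" where "u b = (if b = b0 then 1 else 0)" for b
  have "(L2_set u B)\<^sup>2 = (\<Sum>b\<in>B. if b = b0 then 1 else 0)"
    unfolding L2_set_square by (intro sum.cong) (auto simp: u_def)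
  then have "(L2_set u B)\<^sup>2 = 1" using assms b0 by simp
  then have "L2_set u B = 1" using L2_set_nonneg[of u B] by (simp add: power2_eq_1_iff)
  then show ?thesis using that[of u "1/2"] S by simp
next
  case False
  define s where "s = L2_set S B"
  have s: "s > 0" using False L2_set_nonneg[of S B] by (simp add: s_def less_le)
  define u where "u b = - S b / s" for b
  define c where "c = min (1/2) (1 / s)"
  have "(L2_set u B)\<^sup>2 = (L2_set S B)\<^sup>2 / s\<^sup>2"
    unfolding L2_set_square by (simp add: u_def power_divide sum_divide_distrib)
  then have "(L2_set u B)\<^sup>2 = 1" using s by (simp add: s_def)
  then have u: "L2_set u B = 1" using L2_set_nonneg[of u B] by (simp add: power2_eq_1_iff)
  have "(\<Sum>b\<in>B. v b * S b) \<le> 1" if "- c \<le> (\<Sum>b\<in>B. v b * u b)" for v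
  proof -
    have "(\<Sum>b\<in>B. v b * S b) = - s * (\<Sum>b\<in>B. v b * u b)"
      using s by (simp add: u_def sum_distrib_left)
    also have "\<dots> \<le> s * c" using mult_left_mono[OF that, of s] s by simp
    also have "\<dots> \<le> s * (1 / s)" using s by (intro mult_left_mono) (auto simp: c_def)
    finally show ?thesis using s by simp
  qed
  then show ?thesis using that[OF u, of c] s by (simp add: c_def)
qed

text \<open>Only multiples of \<open>M\<close> are guaranteed as coordinates, so real vectors are
  later rounded to that sublattice. \<open>finite_boxes\<close> also accounts for torsion, which the
  coordinates do not see.\<close>

locale lattice_system = expansive_scale G X T n e a m
  for G :: "('g, 'm) monoid_scheme" (structure) and X :: "'x::metric_space set"
    and T :: "'g \<Rightarrow> 'x \<Rightarrow> 'x" and n :: nat and e :: real and a :: "nat \<Rightarrow> 'g" and m :: nat +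
  fixes B :: "'d set" and p :: "'g \<Rightarrow> 'd \<Rightarrow> int" and M :: int
  assumes finite_B: "finite B"
    and p_mult: "\<And>g h b. g \<in> carrier G \<Longrightarrow> h \<in> carrier G \<Longrightarrow> p (g \<otimes> h) b = p g b + p h b"
    and M: "M > 0"
    and p_surj: "\<And>f. \<exists>g\<in>carrier G. \<forall>b\<in>B. p g b = M * f b"
    and finite_boxes: "\<And>R. finite {g \<in> carrier G. \<forall>b\<in>B. \<bar>p g b\<bar> \<le> R}"
begin

definition coord :: "'g \<Rightarrow> 'd \<Rightarrow> real" where
  "coord g b = real_of_int (p g b)"

definition inner_coord :: "('d \<Rightarrow> real) \<Rightarrow> 'g \<Rightarrow> real" where
  "inner_coord v g = (\<Sum>b\<in>B. v b * coord g b)"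

lemma coord_mult: "g \<in> carrier G \<Longrightarrow> h \<in> carrier G \<Longrightarrow> coord (g \<otimes> h) b = coord g b + coord h b"
  by (simp add: coord_def p_mult)

lemma inner_coord_mult:
  "g \<in> carrier G \<Longrightarrow> h \<in> carrier G \<Longrightarrow> inner_coord v (g \<otimes> h) = inner_coord v g + inner_coord v h"
  by (simp add: inner_coord_def coord_mult distrib_left sum.distrib)

lemma finite_balls: "finite {g \<in> carrier G. L2_set (coord g) B < R}"
proof (rule finite_subset[OF _ finite_boxes[of "\<lceil>R\<rceil>"]])
  show "{g \<in> carrier G. L2_set (coord g) B < R} \<subseteq> {g \<in> carrier G. \<forall>b\<in>B. \<bar>p g b\<bar> \<le> \<lceil>R\<rceil>}"
  proof clarify
    fix g b assume g: "L2_set (coord g) B < R" and b: "b \<in> B"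
    have "(coord g b)\<^sup>2 \<le> (L2_set (coord g) B)\<^sup>2"
      unfolding L2_set_square using b finite_B
      by (intro member_le_sum[of b B "\<lambda>b. (coord g b)\<^sup>2"]) auto
    then have "\<bar>coord g b\<bar> \<le> L2_set (coord g) B"
      using abs_le_square_iff[of "coord g b" "L2_set (coord g) B"] L2_set_nonneg[of "coord g" B] by simp
    then have "\<bar>coord g b\<bar> \<le> R" using g by simp
    then show "\<bar>p g b\<bar> \<le> \<lceil>R\<rceil>" unfolding coord_def by linarith
  qed
qed

text \<open>A pair of points that is not \<open>e\<close>-close yet, but will be throughout a large ball supported by
  the hyperplane orthogonal to \<open>v\<close>.\<close>

definition supported_pair :: "real \<Rightarrow> ('d \<Rightarrow> real) \<Rightarrow> 'x \<Rightarrow> 'x \<Rightarrow> bool" where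
  "supported_pair R v x y \<longleftrightarrow> x \<in> X \<and> y \<in> X \<and> e \<le> dist x y \<and>
     (\<forall>k\<in>carrier G. ((L2_set (coord k) B)\<^sup>2 + 1) / R < 2 * inner_coord v k \<longrightarrow> dist (T k x) (T k y) \<le> e)"

text \<open>The ball of radius \<open>R + c t\<close> around \<open>- t u\<close> starts out free of bad times and moves in direction
  \<open>- u\<close> faster than it grows, so it first meets a bad time at a point of its boundary whose inner
  normal \<open>v\<close> satisfies \<open>v \<bullet> u \<ge> - c\<close>.\<close>

lemma first_contact:
  assumes u: "L2_set u B = 1" and c: "0 < c" "c < 1" and R: "0 < R"
    and xy: "x \<in> X" "y \<in> X"
    and init: "\<And>g. g \<in> carrier G \<Longrightarrow> L2_set (coord g) B < R \<Longrightarrow> dist (T g x) (T g y) \<le> e"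
    and bad: "0 \<le> t" "g \<in> carrier G" "L2_set (\<lambda>b. coord g b + t * u b) B < R + c * t"
      "e < dist (T g x) (T g y)"
  shows "\<exists>v x y. L2_set v B = 1 \<and> - c \<le> (\<Sum>b\<in>B. v b * u b) \<and> supported_pair R v x y"
proof -
  \<comment> \<open>The distance of \<open>g\<close> from the center \<open>- t * u\<close>; it is
    1-Lipschitz in \<open>t\<close> because \<open>u\<close> is a unit vector.\<close>
  define N where "N g t = L2_set (\<lambda>b. coord g b + t * u b) B" for g t
  have N_nonneg: "0 \<le> N g t" for g t unfolding N_def by (rule L2_set_nonneg)
  have shift: "N g t \<le> N g t' + \<bar>t - t'\<bar>" for g t t'
  proof -
    have "L2_set (\<lambda>b. (t - t') * u b) B = \<bar>t - t'\<bar>"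
    proof -
      have "(L2_set (\<lambda>b. (t - t') * u b) B)\<^sup>2 = (t - t')\<^sup>2 * (L2_set u B)\<^sup>2"
        unfolding L2_set_square by (simp add: power_mult_distrib sum_distrib_left)
      then have "(L2_set (\<lambda>b. (t - t') * u b) B)\<^sup>2 = \<bar>t - t'\<bar>\<^sup>2" using u by simp
      then show ?thesis by (rule power2_eq_imp_eq[OF _ L2_set_nonneg abs_ge_zero])
    qed
    moreover have "N g t = L2_set (\<lambda>b. (coord g b + t' * u b) + (t - t') * u b) B"
      unfolding N_def by (simp add: algebra_simps)
    ultimately show ?thesis
      using L2_set_triangle_ineq[of "\<lambda>b. coord g b + t' * u b" "\<lambda>b. (t - t') * u b" B]
      by (simp add: N_def)
  qed
  define A where "A = {t. 0 \<le> t \<and> (\<exists>g\<in>carrier G. N g t < R + c * t \<and> e < dist (T g x) (T g y))}"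
  have A: "A \<noteq> {}" "bdd_below A"
    using bad by (auto simp: A_def N_def intro!: bdd_belowI[of _ 0])
  define t0 where "t0 = Inf A"
  have t0: "0 \<le> t0" unfolding t0_def using A(1) by (intro cInf_greatest) (auto simp: A_def)
  have good0: "dist (T g x) (T g y) \<le> e" if g: "g \<in> carrier G" "N g t0 < R + c * t0" for g
  proof (rule ccontr)
    assume bad0: "\<not> dist (T g x) (T g y) \<le> e"
    show False
    proof (cases "t0 = 0")
      case True
      then show False using bad0 init[OF g(1)] g(2) by (simp add: N_def)
    next
      case False
      \<comment> \<open>Going back by \<open>s\<close> raises the distance by at most
        \<open>s\<close> and lowers the radius by at most \<open>s\<close>, so a third of the slack
        keeps the bad time inside an earlier ball.\<close>
      define s where "s = min t0 ((R + c * t0 - N g t0) / 3)"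
      have "s \<le> (R + c * t0 - N g t0) / 3" unfolding s_def by (rule min.cobounded2)
      then have s: "0 < s" "s \<le> t0" "3 * s \<le> R + c * t0 - N g t0"
        using False t0 g(2) by (auto simp: s_def)
      have "c * s \<le> s" using c s by (simp add: mult_left_le_one_le)
      moreover have "N g (t0 - s) \<le> N g t0 + s" using shift[of g "t0 - s" t0] s by simp
      ultimately have "N g (t0 - s) < R + c * (t0 - s)"
        using s unfolding right_diff_distrib by linarith
      then have "t0 - s \<in> A" using g(1) bad0 s by (auto simp: A_def not_le)
      then have "t0 \<le> t0 - s" unfolding t0_def using A(2) by (rule cInf_lower)
      then show False using s by simp
    qed
  qed
  define r where "r = R + c * t0"
  have r: "R \<le> r" "0 < r" using c R t0 by (auto simp: r_def add_pos_nonneg)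
  \<comment> \<open>The open ball at \<open>t0\<close> has no bad time, so the contact is read off
    slightly later. The margin gives \<open>s * (4 * r + 4) < 1\<close>, which keeps
    \<open>L\<^sup>2\<close> below \<open>r\<^sup>2 + 1\<close>.\<close>
  have "Inf A < t0 + 1 / (4 * r + 4)" using r by (simp add: t0_def)
  from cInf_lessD[OF A(1) this] obtain t1 where t1: "t1 \<in> A" "t1 < t0 + 1 / (4 * r + 4)" by blast
  obtain h where h: "h \<in> carrier G" "N h t1 < R + c * t1" "e < dist (T h x) (T h y)"
    using t1(1) by (auto simp: A_def)
  define s where "s = t1 - t0"
  have "t0 \<le> t1" unfolding t0_def using t1(1) A(2) by (rule cInf_lower)
  moreover have "t1 \<noteq> t0" using good0[OF h(1)] h by force
  ultimately have s: "0 < s" "t1 = t0 + s" by (auto simp: s_def)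
  have s1: "s * (4 * r + 4) < 1" using t1(2) r by (simp add: s field_simps)
  have "s < 1" using s1 s r by (smt (verit) mult_le_cancel_left1)
  define w where "w b = coord h b + t0 * u b" for b
  define L where "L = L2_set w B"
  have LN: "L = N h t0" by (simp add: L_def N_def w_def[abs_def])
  have rL: "r \<le> L" using good0[OF h(1)] h(3) LN by (force simp: r_def not_less[symmetric])
  then have L: "0 < L" using r by simp
  have h2: "N h t1 < r + c * s" using h(2) s by (simp add: r_def distrib_left)
  have cs: "c * s \<le> s" using c s by (simp add: mult_left_le_one_le)
  moreover have "L \<le> N h t1 + s" using shift[of h t0 t1] s LN by simp
  ultimately have "L < r + 2 * s" using h2 by linarith
  then have "L\<^sup>2 \<le> (r + 2 * s)\<^sup>2" using L by (intro power_mono) auto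
  also have "\<dots> = r\<^sup>2 + s * (4 * r + 4 * s)" by (simp add: power2_eq_square algebra_simps)
  also have "\<dots> \<le> r\<^sup>2 + s * (4 * r + 4)"
    using s \<open>s < 1\<close> by (intro add_left_mono mult_left_mono) auto
  finally have L2: "L\<^sup>2 < r\<^sup>2 + 1" using s1 by simp
  \<comment> \<open>The vector \<open>w\<close> has norm at least \<open>r\<close>, but after adding
    \<open>s * u\<close> the norm is below \<open>r + c * s\<close>. Expanding the squares and using
    \<open>c * s \<le> s\<close> isolates the inner product.\<close>
  have inner: "(\<Sum>b\<in>B. w b * u b) \<le> c * r"
  proof -
    have "(N h t1)\<^sup>2 = (\<Sum>b\<in>B. (w b + s * u b)\<^sup>2)"
      unfolding N_def L2_set_square by (simp add: w_def s algebra_simps)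
    also have "\<dots> = L\<^sup>2 + 2 * s * (\<Sum>b\<in>B. w b * u b) + s\<^sup>2 * (L2_set u B)\<^sup>2"
      unfolding L_def L2_set_square
      by (simp add: power2_sum power_mult_distrib sum.distrib sum_distrib_left algebra_simps)
    finally have 1: "(N h t1)\<^sup>2 = L\<^sup>2 + 2 * s * (\<Sum>b\<in>B. w b * u b) + s\<^sup>2" using u by simp
    have "(N h t1)\<^sup>2 \<le> (r + c * s)\<^sup>2" using h2 N_nonneg by (intro power_mono) auto
    moreover have "r\<^sup>2 \<le> L\<^sup>2" using rL r by (intro power_mono) auto
    moreover have "(c * s)\<^sup>2 \<le> s\<^sup>2" using cs c s by (intro power_mono) auto
    ultimately have "2 * s * (\<Sum>b\<in>B. w b * u b) \<le> 2 * s * (c * r)"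
      using 1 by (simp add: power2_sum algebra_simps)
    then show ?thesis using s by (simp add: mult_le_cancel_left_pos)
  qed
  define v where "v b = - w b / L" for b
  have "(L2_set v B)\<^sup>2 = (L2_set w B)\<^sup>2 / L\<^sup>2"
    unfolding L2_set_square by (simp add: v_def power_divide sum_divide_distrib)
  then have "(L2_set v B)\<^sup>2 = 1" using L by (simp add: L_def)
  then have v1: "L2_set v B = 1" using L2_set_nonneg[of v B] by (simp add: power2_eq_1_iff)
  have "(\<Sum>b\<in>B. v b * u b) = - (\<Sum>b\<in>B. w b * u b) / L"
    by (simp add: v_def sum_negf sum_divide_distrib)
  moreover have "(\<Sum>b\<in>B. w b * u b) \<le> c * L"
    using inner mult_left_mono[OF rL, of c] c by linarith
  then have "(\<Sum>b\<in>B. w b * u b) / L \<le> c" using L by (simp add: divide_le_eq)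
  ultimately have v2: "- c \<le> (\<Sum>b\<in>B. v b * u b)" by simp
  \<comment> \<open>For unit \<open>v\<close> the condition says that the squared distance of
    \<open>k\<close> from \<open>R * v\<close> is below \<open>R\<^sup>2 - 1\<close>. The 1 given
    away here pays for \<open>L\<^sup>2 < r\<^sup>2 + 1\<close>, so \<open>k \<otimes> h\<close>
    falls into the open ball at \<open>t0\<close>.\<close>
  have "dist (T k (T h x)) (T k (T h y)) \<le> e"
    if k: "k \<in> carrier G" and kv: "((L2_set (coord k) B)\<^sup>2 + 1) / R < 2 * inner_coord v k" for k
  proof -
    have kR: "(L2_set (coord k) B)\<^sup>2 + 1 < 2 * inner_coord v k * R"
      using kv R by (simp add: divide_less_eq)
    then have "0 < 2 * inner_coord v k * R" by (smt (verit) zero_le_power2)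
    then have "0 < inner_coord v k" using R by (simp add: zero_less_mult_iff)
    then have "2 * inner_coord v k * R \<le> 2 * inner_coord v k * L"
      using rL r by (intro mult_left_mono) auto
    also have "\<dots> = 2 * (L * inner_coord v k)" by simp
    finally have kL: "(L2_set (coord k) B)\<^sup>2 + 1 < 2 * (L * inner_coord v k)" using kR by linarith
    have "L * inner_coord v k = - (\<Sum>b\<in>B. w b * coord k b)"
      using L by (simp add: inner_coord_def v_def sum_distrib_left sum_negf)
    moreover have "(N (k \<otimes> h) t0)\<^sup>2 = (\<Sum>b\<in>B. (w b + coord k b)\<^sup>2)"
      unfolding N_def L2_set_square by (simp add: w_def coord_mult k h(1) algebra_simps)
    moreover have "(\<Sum>b\<in>B. (w b + coord k b)\<^sup>2) =
        L\<^sup>2 + 2 * (\<Sum>b\<in>B. w b * coord k b) + (L2_set (coord k) B)\<^sup>2"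
      unfolding L_def L2_set_square
      by (simp add: power2_sum sum.distrib sum_distrib_left algebra_simps)
    ultimately have "(N (k \<otimes> h) t0)\<^sup>2 < r\<^sup>2" using kL L2 by simp
    then have "N (k \<otimes> h) t0 < R + c * t0" using r power2_less_imp_less unfolding r_def by force
    then show ?thesis using good0[of "k \<otimes> h"] k h(1) xy by (simp add: act_mult)
  qed
  then have "supported_pair R v (T h x) (T h y)"
    using h xy by (auto simp: supported_pair_def)
  then show ?thesis using v1 v2 by blast
qed

text \<open>If every \<open>d\<close>-close pair stays \<open>e\<close>-close on the cone swept out by the moving balls, then elements
  deep inside the cone contract all \<open>d\<close>-balls to arbitrarily small sets, although they permute \<open>X\<close>.\<close>

lemma not_contracting_cone:
  assumes u: "L2_set u B = 1" and c: "0 < c" and R: "0 < R" and d: "0 < d"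
  shows "\<exists>x\<in>X. \<exists>y\<in>X. dist x y < d \<and> (\<exists>t\<ge>0. \<exists>g\<in>carrier G.
    L2_set (\<lambda>b. coord g b + t * u b) B < R + c * t \<and> e < dist (T g x) (T g y))"
proof (rule ccontr)
  assume "\<not> ?thesis"
  then have good: "dist (T g x) (T g y) \<le> e" if "x \<in> X" "y \<in> X" "dist x y < d" "0 \<le> t"
    "g \<in> carrier G" "L2_set (\<lambda>b. coord g b + t * u b) B < R + c * t" for x y t g
    using that by force
  \<comment> \<open>Pigeonhole: \<open>D\<close> has one point more than there are
    \<open>d / 2\<close>-balls in a cover of \<open>X\<close>, and contraction below the separation
    \<open>d'\<close> of \<open>D\<close> is contradictory.\<close>
  obtain C where C: "finite C" "X \<subseteq> (\<Union>x\<in>C. ball x (d / 2))"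
    using seq_compact_imp_totally_bounded[of X] compact_space d half_gt_zero[of d]
    unfolding compact_eq_seq_compact_metric by blast
  obtain D where D: "finite D" "card D = card C + 1" "D \<subseteq> X"
    using infinite_arbitrarily_large[OF infinite_space] by blast
  have "\<exists>d'>0. \<forall>q\<in>{q \<in> D \<times> D. fst q \<noteq> snd q}. d' \<le> dist (fst q) (snd q)"
  proof (rule finite_common_positive)
    show "finite {q \<in> D \<times> D. fst q \<noteq> snd q}" using D by simp
    show "\<exists>d'>0. d' \<le> dist (fst q) (snd q)" if "q \<in> {q \<in> D \<times> D. fst q \<noteq> snd q}" for q
      using that by (intro exI[of _ "dist (fst q) (snd q)"]) auto
  qed auto
  then obtain d' where d': "d' > 0" "\<And>x y. x \<in> D \<Longrightarrow> y \<in> D \<Longrightarrow> x \<noteq> y \<Longrightarrow> d' \<le> dist x y" by force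
  obtain F where F0: "finite F \<and> F \<subseteq> carrier G \<and>
      (\<forall>x\<in>X. \<forall>y\<in>X. (\<forall>g\<in>F. dist (T g x) (T g y) \<le> e) \<longrightarrow> dist x y < d')"
    using finite_expansive[OF d'(1)] by (rule exE)
  then have F: "finite F" "F \<subseteq> carrier G" by simp_all
  have expand: "dist x y < d'"
    if "x \<in> X" "y \<in> X" "\<And>g. g \<in> F \<Longrightarrow> dist (T g x) (T g y) \<le> e" for x y
    by (rule F0[THEN conjunct2, THEN conjunct2, rule_format, OF that])
  define \<rho> where "\<rho> = (\<Sum>f\<in>F. L2_set (coord f) B)"
  have \<rho>: "L2_set (coord f) B \<le> \<rho>" if "f \<in> F" for f
    unfolding \<rho>_def using F(1) that by (intro member_le_sum) auto
  define \<kappa> where "\<kappa> = real_of_int M * real (card B)"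
  \<comment> \<open>At this \<open>t\<close> the radius has grown by
    \<open>\<rho> + \<kappa>\<close>: \<open>\<rho>\<close> allows for composition with an element
    of \<open>F\<close>, and \<open>\<kappa>\<close> for rounding \<open>- t * u\<close> to
    multiples of \<open>M\<close>.\<close>
  define t where "t = (\<rho> + \<kappa>) / c"
  have "0 \<le> \<rho>" "0 \<le> \<kappa>" using M by (auto simp: \<rho>_def \<kappa>_def intro: sum_nonneg)
  then have t: "0 \<le> t" "c * t = \<rho> + \<kappa>" using c by (simp_all add: t_def)
  obtain g where g: "g \<in> carrier G" "\<And>b. b \<in> B \<Longrightarrow> p g b = M * \<lfloor>- t * u b / M\<rfloor>"
    using p_surj[of "\<lambda>b. \<lfloor>- t * u b / M\<rfloor>"] by blast
  have near: "\<bar>coord g b + t * u b\<bar> \<le> M" if "b \<in> B" for b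
  proof -
    define q where "q = - t * u b / M"
    have M': "0 < real_of_int M" using M by simp
    have "coord g b = M * real_of_int \<lfloor>q\<rfloor>" using g(2)[OF that] by (simp add: coord_def q_def)
    moreover have "t * u b = - (M * q)" using M' by (simp add: q_def)
    ultimately have "coord g b + t * u b = - (M * (q - real_of_int \<lfloor>q\<rfloor>))" by (simp add: algebra_simps)
    moreover have "0 \<le> q - real_of_int \<lfloor>q\<rfloor>" "q - real_of_int \<lfloor>q\<rfloor> \<le> 1" by linarith+
    then have "0 \<le> M * (q - real_of_int \<lfloor>q\<rfloor>)" "M * (q - real_of_int \<lfloor>q\<rfloor>) \<le> M"
      using M' by (auto intro: mult_left_le)
    ultimately show ?thesis by simp
  qed
  have "L2_set (\<lambda>b. coord g b + t * u b) B \<le> (\<Sum>b\<in>B. \<bar>coord g b + t * u b\<bar>)"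
    by (rule L2_set_le_sum_abs)
  also have "\<dots> \<le> \<kappa>" using sum_bounded_above[of B "\<lambda>b. \<bar>coord g b + t * u b\<bar>" "real_of_int M"] near
    by (simp add: \<kappa>_def mult.commute)
  finally have gt: "L2_set (\<lambda>b. coord g b + t * u b) B \<le> \<kappa>" .
  have contract: "dist (T g x) (T g y) < d'" if xy: "x \<in> X" "y \<in> X" "dist x y < d" for x y
  proof (rule expand)
    fix f assume f: "f \<in> F"
    then have fG: "f \<in> carrier G" using F(2) by blast
    have "L2_set (\<lambda>b. coord (f \<otimes> g) b + t * u b) B =
        L2_set (\<lambda>b. coord f b + (coord g b + t * u b)) B"
      using fG g(1) by (simp add: coord_mult add.assoc)
    also have "\<dots> \<le> \<rho> + \<kappa>"
      using L2_set_triangle_ineq[of "coord f" "\<lambda>b. coord g b + t * u b" B] \<rho>[OF f] gt by simp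
    also have "\<dots> < R + c * t" using t R by simp
    finally have "dist (T (f \<otimes> g) x) (T (f \<otimes> g) y) \<le> e"
      using good[OF xy t(1)] fG g(1) by blast
    then show "dist (T f (T g x)) (T f (T g y)) \<le> e" using fG g(1) xy by (simp add: act_mult)
  qed (use g xy in auto)
  \<comment> \<open>After pulling \<open>D\<close> back by \<open>g\<close>, two of its points share
    a \<open>d / 2\<close>-ball; applying \<open>T g\<close> brings them back within
    \<open>d'\<close>.\<close>
  have "\<forall>x\<in>D. \<exists>c\<in>C. dist c (T (inv g) x) < d / 2"
    using C(2) D(3) g(1) by (auto simp: subset_iff dest: T_closed[OF inv_closed[OF g(1)]])
  then obtain j where j: "\<And>x. x \<in> D \<Longrightarrow> j x \<in> C" "\<And>x. x \<in> D \<Longrightarrow> dist (j x) (T (inv g) x) < d / 2"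
    by metis
  have "card (j ` D) \<le> card C" using j(1) C(1) by (intro card_mono) auto
  then have "\<not> inj_on j D" using D(2) card_image[of j D] by auto
  then obtain x y where xy: "x \<in> D" "y \<in> D" "x \<noteq> y" "j x = j y" by (auto simp: inj_on_def)
  have X: "x \<in> X" "y \<in> X" using xy D by auto
  have "dist (T (inv g) x) (T (inv g) y) < d"
    using j(2)[OF xy(1)] j(2)[OF xy(2)] xy(4) by (metis dist_triangle_half_r)
  then have "dist (T g (T (inv g) x)) (T g (T (inv g) y)) < d'"
    using contract X g(1) by simp
  then show False using d'(2)[OF xy(1-3)] X g(1) by (simp add: T_inv')
qed

text \<open>The ball of radius \<open>R\<close> contains finitely many times, so sufficiently close
  pairs start without bad times; \<open>not_contracting_cone\<close> yields such a pair that meets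
  one later.\<close>

lemma supported_pair_exists:
  assumes "B \<noteq> {}" and R: "0 < R"
  shows "\<exists>v x y. L2_set v B = 1 \<and> (\<Sum>b\<in>B. v b * S b) \<le> 1 \<and> supported_pair R v x y"
proof -
  obtain u c where u: "L2_set u B = 1" "0 < c" "c < 1"
    "\<And>v. - c \<le> (\<Sum>b\<in>B. v b * u b) \<Longrightarrow> (\<Sum>b\<in>B. v b * S b) \<le> 1"
    using unit_direction_for_half_space[OF finite_B assms(1), of S] by blast
  define F where "F = {g \<in> carrier G. L2_set (coord g) B < R}"
  obtain d where d: "d > 0"
    "\<And>g x y. g \<in> F \<Longrightarrow> x \<in> X \<Longrightarrow> y \<in> X \<Longrightarrow> dist x y < d \<Longrightarrow> dist (T g x) (T g y) \<le> e"
    using uniformly_close[of F e] finite_balls e unfolding F_def by blast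
  obtain x y t g where *: "x \<in> X" "y \<in> X" "dist x y < d" "0 \<le> t" "g \<in> carrier G"
    "L2_set (\<lambda>b. coord g b + t * u b) B < R + c * t" "e < dist (T g x) (T g y)"
    using not_contracting_cone[OF u(1,2) R d(1)] by blast
  have "\<exists>v x y. L2_set v B = 1 \<and> - c \<le> (\<Sum>b\<in>B. v b * u b) \<and> supported_pair R v x y"
    by (rule first_contact[OF u(1-3) R *(1,2) _ *(4-7)]) (use d(2) * in \<open>auto simp: F_def\<close>)
  then show ?thesis using u(4) by blast
qed

end

section \<open>Avoiding a cover by close pairs\<close>

context self_joining_system
begin

lemma joint_orbit_dense_set:
  assumes W: "finite W" "W \<subseteq> X" "W \<noteq> {}" "card W \<le> n"
    and orb: "\<And>w w' g. w \<in> W \<Longrightarrow> w' \<in> W \<Longrightarrow> w \<noteq> w' \<Longrightarrow> g \<in> carrier G \<Longrightarrow> w' \<noteq> T g w"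
    and z: "\<And>w. w \<in> W \<Longrightarrow> z w \<in> X" and d: "d > 0"
  shows "\<exists>g\<in>carrier G. \<forall>w\<in>W. dist (T g w) (z w) < d"
proof -
  obtain h where "bij_betw h {0..<card W} W" using ex_bij_betw_nat_finite[OF W(1)] by blast
  then have h: "inj_on h {..<card W}" "h ` {..<card W} = W"
    by (simp_all add: bij_betw_def atLeast0LessThan)
  have hW: "h i \<in> W" if "i < card W" for i using h(2) that by blast
  have "1 \<le> card W" using W by (simp add: Suc_le_eq card_gt_0_iff)
  then have "\<exists>g\<in>carrier G. \<forall>i<card W. dist (T g (h i)) (z (h i)) < d"
  proof (rule joint_orbit_dense[OF _ W(4) _ _ _ d])
    show "h i \<in> X" if "i < card W" for i using hW[OF that] W(2) by blast
    show "h j \<noteq> T g (h i)" if "i < card W" "j < card W" "i \<noteq> j" "g \<in> carrier G" for i j g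
      using that hW h(1) by (intro orb) (auto simp: inj_on_def)
    show "z (h i) \<in> X" if "i < card W" for i using z hW[OF that] by blast
  qed
  then obtain g where g: "g \<in> carrier G" "\<And>i. i < card W \<Longrightarrow> dist (T g (h i)) (z (h i)) < d" by blast
  have "dist (T g w) (z w) < d" if "w \<in> W" for w
  proof -
    have "w \<in> h ` {..<card W}" using h(2) that by simp
    then obtain i where "i < card W" "w = h i" by blast
    then show ?thesis using g(2) by simp
  qed
  then show ?thesis using g(1) by blast
qed

text \<open>The predicate under \<open>SOME\<close> depends only on the orbit of \<open>x\<close>,
  so a whole orbit gets one representative. Only points of different orbits can be steered
  independently.\<close>

definition orbit_rep :: "'x \<Rightarrow> 'x" where
  "orbit_rep x = (SOME z. \<exists>g\<in>carrier G. z = T g x)"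

lemma orbit_rep_in_orbit:
  assumes "x \<in> X" obtains g where "g \<in> carrier G" "orbit_rep x = T g x"
proof -
  have "\<exists>g\<in>carrier G. orbit_rep x = T g x"
    unfolding orbit_rep_def by (rule someI[of _ "T \<one> x"]) blast
  then show ?thesis using that by blast
qed

lemma orbit_rep_T:
  assumes "g \<in> carrier G" "x \<in> X" shows "orbit_rep (T g x) = orbit_rep x"
proof -
  have "(\<exists>k\<in>carrier G. z = T k (T g x)) \<longleftrightarrow> (\<exists>k\<in>carrier G. z = T k x)" for z
  proof
    assume "\<exists>k\<in>carrier G. z = T k (T g x)"
    then obtain k where "k \<in> carrier G" "z = T k (T g x)" by blast
    then show "\<exists>k\<in>carrier G. z = T k x"
      using assms by (intro bexI[of _ "k \<otimes> g"]) (simp_all add: act_mult)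
  next
    assume "\<exists>k\<in>carrier G. z = T k x"
    then obtain k where k: "k \<in> carrier G" "z = T k x" by blast
    then show "\<exists>k\<in>carrier G. z = T k (T g x)"
      using assms by (intro bexI[of _ "k \<otimes> inv g"]) (simp_all add: act_mult m_assoc)
  qed
  then show ?thesis unfolding orbit_rep_def by simp
qed

lemma orbit_rep_closed: "x \<in> X \<Longrightarrow> orbit_rep x \<in> X"
  by (metis orbit_rep_in_orbit T_closed)

lemma orbit_rep_idem: "x \<in> X \<Longrightarrow> orbit_rep (orbit_rep x) = orbit_rep x"
  by (metis orbit_rep_in_orbit orbit_rep_T)

lemma orbit_rep_reaches: "x \<in> X \<Longrightarrow> \<exists>h\<in>carrier G. x = T h (orbit_rep x)"
  by (metis orbit_rep_in_orbit T_inv inv_closed)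

end

context expansive_scale
begin

text \<open>Orbit representatives are moved one after another to a point \<open>T (a j) y0\<close>. For a fixed
  partner, each pair excludes at most one index \<open>j\<close>, since the points \<open>T (a j) y\<close> are
  more than \<open>2 * e\<close> apart; so \<open>m\<close> choices suffice for fewer than \<open>m\<close> pairs.\<close>

lemma avoid_close_pairs:
  assumes I: "finite I" "card I < m"
    and h: "\<And>i. i \<in> I \<Longrightarrow> h i \<in> carrier G" "\<And>i. i \<in> I \<Longrightarrow> h' i \<in> carrier G"
    and ne: "\<And>i. i \<in> I \<Longrightarrow> s i \<noteq> (s' i :: 'c)"
    and V: "finite V"
  shows "\<exists>z. (\<forall>w. z w \<in> X) \<and> (\<forall>i\<in>I. s i \<in> V \<longrightarrow> s' i \<in> V \<longrightarrow>
    e < dist (T (h i) (z (s i))) (T (h' i) (z (s' i))))"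
  using V
proof (induction V rule: finite_induct)
  case empty
  obtain x where "x \<in> X" using infinite_space by (metis finite.emptyI all_not_in_conv)
  then show ?case by (intro exI[of _ "\<lambda>_. x"]) simp
next
  case (insert w V)
  then obtain z where z: "\<And>w. z w \<in> X"
    "\<And>i. i \<in> I \<Longrightarrow> s i \<in> V \<Longrightarrow> s' i \<in> V \<Longrightarrow> e < dist (T (h i) (z (s i))) (T (h' i) (z (s' i)))"
    by blast
  obtain y0 where y0: "y0 \<in> X" using infinite_space by (metis finite.emptyI all_not_in_conv)
  define z' where "z' j = z(w := T (a j) y0)" for j
  define bad where "bad i = {j. j < m \<and> (s i = w \<or> s' i = w) \<and>
    dist (T (h i) (z' j (s i))) (T (h' i) (z' j (s' i))) \<le> e}" for i
  have unique: "j = j'"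
    if i: "i \<in> I" and j: "j < m" "j' < m" and k: "k \<in> carrier G"
      and d: "dist (T k (T (a j) y0)) q \<le> e" "dist (T k (T (a j') y0)) q \<le> e" for i j j' k q
  proof (rule ccontr)
    assume "j \<noteq> j'"
    then have "2 * e < dist (T (a j) (T k y0)) (T (a j') (T k y0))"
      using separated j k y0 by simp
    also have "\<dots> = dist (T k (T (a j) y0)) (T k (T (a j') y0))"
      using T_commute[OF a[OF j(1)] k y0] T_commute[OF a[OF j(2)] k y0] by simp
    also have "\<dots> \<le> dist (T k (T (a j) y0)) q + dist (T k (T (a j') y0)) q"
      by (rule dist_triangle2)
    finally show False using d by simp
  qed
  have bad1: "card (bad i) \<le> 1" if i: "i \<in> I" for i
  proof -
    have "j = j'" if j: "j \<in> bad i" "j' \<in> bad i" for j j'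
    proof (cases "s i = w")
      case True
      then have "s' i \<noteq> w" using ne[OF i] by simp
      then show ?thesis
        using j True by (intro unique[OF i _ _ h(1)[OF i], of j j' "T (h' i) (z (s' i))"])
          (simp_all add: bad_def z'_def)
    next
      case False
      then have "s' i = w" using j by (simp add: bad_def)
      then show ?thesis
        using j False by (intro unique[OF i _ _ h(2)[OF i], of j j' "T (h i) (z (s i))"])
          (simp_all add: bad_def z'_def dist_commute)
    qed
    moreover have "finite (bad i)" by (simp add: bad_def)
    ultimately show ?thesis by (simp add: card_le_Suc0_iff_eq)
  qed
  have "card (\<Union>i\<in>I. bad i) \<le> (\<Sum>i\<in>I. card (bad i))" by (rule card_UN_le[OF I(1)])
  also have "\<dots> \<le> (\<Sum>i\<in>I. 1)" using bad1 by (intro sum_mono) auto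
  also have "\<dots> < card {..<m}" using I(2) by simp
  finally have "\<not> {..<m} \<subseteq> (\<Union>i\<in>I. bad i)"
    using card_mono[of "\<Union>i\<in>I. bad i" "{..<m}"] I(1) by (force simp: bad_def)
  then obtain j where j: "j < m" "\<And>i. i \<in> I \<Longrightarrow> j \<notin> bad i" by blast
  show ?case
  proof (intro exI[of _ "z' j"] conjI allI ballI impI)
    show "z' j v \<in> X" for v using z(1) a[OF j(1)] y0 by (simp add: z'_def)
    fix i assume i: "i \<in> I" "s i \<in> insert w V" "s' i \<in> insert w V"
    show "e < dist (T (h i) (z' j (s i))) (T (h' i) (z' j (s' i)))"
    proof (cases "s i = w \<or> s' i = w")
      case True
      then show ?thesis using j(1) j(2)[OF i(1)] unfolding bad_def by auto
    next
      case False
      then show ?thesis using i z(2)[OF i(1)] by (simp add: z'_def)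
    qed
  qed
qed

text \<open>Each pair consists of fixed translates of two representatives.
  \<open>avoid_close_pairs\<close> supplies targets at which all pairs are more than
  \<open>e\<close> apart, the joint orbit of the representatives approximates the targets, and
  continuity preserves the finitely many strict inequalities.\<close>

lemma no_close_cover:
  assumes I: "finite I" "I \<noteq> {}" "card I < m" "2 * card I \<le> n"
    and X: "\<And>i. i \<in> I \<Longrightarrow> x i \<in> X" "\<And>i. i \<in> I \<Longrightarrow> y i \<in> X"
    and orb: "\<And>i g. i \<in> I \<Longrightarrow> g \<in> carrier G \<Longrightarrow> y i \<noteq> T g (x i)"
  shows "\<exists>g\<in>carrier G. \<forall>i\<in>I. e < dist (T g (x i)) (T g (y i))"
proof -
  define s where "s i = orbit_rep (x i)" for i
  define s' where "s' i = orbit_rep (y i)" for i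
  obtain h where h: "\<And>i. i \<in> I \<Longrightarrow> h i \<in> carrier G" "\<And>i. i \<in> I \<Longrightarrow> x i = T (h i) (s i)"
    using orbit_rep_reaches[OF X(1)] unfolding s_def by metis
  obtain h' where h': "\<And>i. i \<in> I \<Longrightarrow> h' i \<in> carrier G" "\<And>i. i \<in> I \<Longrightarrow> y i = T (h' i) (s' i)"
    using orbit_rep_reaches[OF X(2)] unfolding s'_def by metis
  have sX: "s i \<in> X" "s' i \<in> X" if "i \<in> I" for i
    using X[OF that] by (simp_all add: s_def s'_def orbit_rep_closed)
  have ne: "s i \<noteq> s' i" if i: "i \<in> I" for i
  proof
    assume eq: "s i = s' i"
    have "T (h' i \<otimes> inv (h i)) (x i) = T (h' i) (T (inv (h i)) (T (h i) (s i)))"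
      using h[OF i] h'[OF i] X[OF i] by (simp add: act_mult)
    also have "\<dots> = y i" using h[OF i] h'(2)[OF i] sX[OF i] eq by (simp add: T_inv)
    finally show False using orb[OF i, of "h' i \<otimes> inv (h i)"] h[OF i] h'[OF i] by simp
  qed
  define W where "W = s ` I \<union> s' ` I"
  have W: "finite W" "W \<subseteq> X" "W \<noteq> {}" using I sX by (auto simp: W_def)
  have "card W \<le> card (s ` I) + card (s' ` I)" unfolding W_def by (rule card_Un_le)
  also have "\<dots> \<le> 2 * card I" using card_image_le[OF I(1), of s] card_image_le[OF I(1), of s'] by simp
  finally have cardW: "card W \<le> n" using I(4) by simp
  have rep: "orbit_rep w = w" if "w \<in> W" for w
    using that X by (auto simp: W_def s_def s'_def orbit_rep_idem)
  have orbW: "w' \<noteq> T g w" if "w \<in> W" "w' \<in> W" "w \<noteq> w'" "g \<in> carrier G" for w w' g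
    using rep[OF that(1)] rep[OF that(2)] orbit_rep_T[OF that(4), of w] W(2) that by auto
  have "\<exists>z. (\<forall>w. z w \<in> X) \<and> (\<forall>i\<in>I. s i \<in> W \<longrightarrow> s' i \<in> W \<longrightarrow>
      e < dist (T (h i) (z (s i))) (T (h' i) (z (s' i))))"
    by (rule avoid_close_pairs[OF I(1,3) h(1) h'(1) ne W(1)])
  then obtain z where z0: "(\<forall>w. z w \<in> X) \<and> (\<forall>i\<in>I. s i \<in> W \<longrightarrow> s' i \<in> W \<longrightarrow>
      e < dist (T (h i) (z (s i))) (T (h' i) (z (s' i))))" by (rule exE)
  have z: "z w \<in> X" "i \<in> I \<Longrightarrow> e < dist (T (h i) (z (s i))) (T (h' i) (z (s' i)))" for w i
    using z0 by (simp_all add: W_def)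
  have "\<forall>k. \<exists>g\<in>carrier G. \<forall>w\<in>W. dist (T g w) (z w) < 1 / real (Suc k)"
    using joint_orbit_dense_set[OF W cardW orbW z(1)] by simp
  then obtain q where q: "\<And>k. q k \<in> carrier G"
    "\<And>k w. w \<in> W \<Longrightarrow> dist (T (q k) w) (z w) < 1 / real (Suc k)" by metis
  have lim: "(\<lambda>k. T (q k) w) \<longlonglongrightarrow> z w" if "w \<in> W" for w
    using q(2)[OF that] by (rule LIMSEQ_if_dist_less_inverse)
  have "\<forall>\<^sub>F k in sequentially. e < dist (T (q k) (x i)) (T (q k) (y i))" if i: "i \<in> I" for i
  proof (rule order_tendstoD(1)[OF _ z(2)[OF i]])
    have "(\<lambda>k. dist (T (h i) (T (q k) (s i))) (T (h' i) (T (q k) (s' i))))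
        \<longlonglongrightarrow> dist (T (h i) (z (s i))) (T (h' i) (z (s' i)))"
      using h(1)[OF i] h'(1)[OF i] lim[of "s i"] lim[of "s' i"] i q(1) sX[OF i] z(1)
      by (intro tendsto_dist T_tendsto) (auto simp: W_def)
    moreover have "T (h i) (T (q k) (s i)) = T (q k) (x i)" for k
      using T_commute[OF h(1)[OF i] q(1) sX(1)[OF i], of k] h(2)[OF i] by simp
    moreover have "T (h' i) (T (q k) (s' i)) = T (q k) (y i)" for k
      using T_commute[OF h'(1)[OF i] q(1) sX(2)[OF i], of k] h'(2)[OF i] by simp
    ultimately show "(\<lambda>k. dist (T (q k) (x i)) (T (q k) (y i)))
        \<longlonglongrightarrow> dist (T (h i) (z (s i))) (T (h' i) (z (s' i)))" by simp
  qed
  then have "\<forall>\<^sub>F k in sequentially. \<forall>i\<in>I. e < dist (T (q k) (x i)) (T (q k) (y i))"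
    using I(1) by (simp add: eventually_ball_finite)
  then obtain k where "\<forall>i\<in>I. e < dist (T (q k) (x i)) (T (q k) (y i))"
    unfolding eventually_sequentially by blast
  then show ?thesis using q(1) by blast
qed

end

section \<open>Covering the group by half-spaces\<close>

context lattice_system
begin

lemma inner_coord_unbounded:
  assumes "L2_set v B = 1"
  shows "\<exists>g\<in>carrier G. r < inner_coord v g"
proof -
  have "\<exists>b\<in>B. v b \<noteq> 0"
  proof (rule ccontr)
    assume "\<not> ?thesis"
    then have "L2_set v B = 0" using finite_B by (simp add: L2_set_eq_0_iff)
    then show False using assms by simp
  qed
  then obtain b0 where b0: "b0 \<in> B" "v b0 \<noteq> 0" by blast
  define K where "K = \<lceil>\<bar>r\<bar> / \<bar>v b0\<bar>\<rceil> + 1"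
  define s :: int where "s = (if 0 < v b0 then 1 else - 1)"
  have s: "of_int s * v b0 = \<bar>v b0\<bar>" by (simp add: s_def)
  obtain g where g: "g \<in> carrier G" "\<And>b. b \<in> B \<Longrightarrow> p g b = M * (if b = b0 then K * s else 0)"
    using p_surj[of "\<lambda>b. if b = b0 then K * s else 0"] by blast
  have "inner_coord v g = (\<Sum>b\<in>B. if b = b0 then v b0 * real_of_int (M * (K * s)) else 0)"
    unfolding inner_coord_def by (intro sum.cong) (auto simp: coord_def g(2))
  also have "\<dots> = v b0 * real_of_int (M * (K * s))" using b0 finite_B by simp
  also have "\<dots> = real_of_int M * (real_of_int K * \<bar>v b0\<bar>)"
    by (simp add: s[symmetric])
  finally have inner: "inner_coord v g = real_of_int M * (real_of_int K * \<bar>v b0\<bar>)" .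
  have "\<bar>r\<bar> / \<bar>v b0\<bar> < real_of_int K" unfolding K_def by linarith
  then have K: "\<bar>r\<bar> < real_of_int K * \<bar>v b0\<bar>" using b0 by (simp add: divide_less_eq)
  also have "\<dots> \<le> real_of_int M * (real_of_int K * \<bar>v b0\<bar>)"
    using mult_right_mono[of 1 "real_of_int M" "real_of_int K * \<bar>v b0\<bar>"] M K by simp
  finally show ?thesis using inner g(1) by (intro bexI[of _ g]) auto
qed

text \<open>One element far enough inside outweighs the finitely many inner products coming from
  \<open>F\<close>.\<close>

lemma thick_half_space:
  assumes "L2_set v B = 1"
  shows "thick {g \<in> carrier G. 0 < inner_coord v g}"
  unfolding thick_def
proof (intro allI impI)
  fix F assume F: "finite F" "F \<subseteq> carrier G"
  obtain g where g: "g \<in> carrier G" "(\<Sum>f\<in>F. \<bar>inner_coord v f\<bar>) < inner_coord v g"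
    using inner_coord_unbounded[OF assms] by blast
  have "f \<otimes> g \<in> {g \<in> carrier G. 0 < inner_coord v g}" if f: "f \<in> F" for f
  proof -
    have "\<bar>inner_coord v f\<bar> \<le> (\<Sum>f\<in>F. \<bar>inner_coord v f\<bar>)"
      using f F(1) by (intro member_le_sum) auto
    then show ?thesis using f F(2) g by (auto simp: inner_coord_mult subset_iff)
  qed
  then show "\<exists>g\<in>carrier G. \<forall>f\<in>F. f \<otimes> g \<in> {g \<in> carrier G. 0 < inner_coord v g}" using g(1) by blast
qed

text \<open>Limit of supported pairs as the radius grows. Weights, normals and points range over
  compact sets, with a fixed number of indices, so they converge along one subsequence; the bound
  \<open>e \<le> dist x y\<close> is closed and keeps the limit pairs distinct.\<close>

lemma close_on_balancing_half_spaces: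
  assumes "B \<noteq> {}"
  obtains c v x y where "\<And>i. i \<le> card B \<Longrightarrow> (0::real) \<le> c i" "(\<Sum>i\<le>card B. c i) = 1"
    "\<And>b. b \<in> B \<Longrightarrow> (\<Sum>i\<le>card B. c i * v i b) = 0"
    "\<And>i. i \<le> card B \<Longrightarrow> L2_set (v i) B = 1"
    "\<And>i. i \<le> card B \<Longrightarrow> x i \<in> X" "\<And>i. i \<le> card B \<Longrightarrow> y i \<in> X"
    "\<And>i. i \<le> card B \<Longrightarrow> x i \<noteq> y i"
    "\<And>i g. i \<le> card B \<Longrightarrow> g \<in> carrier G \<Longrightarrow> 0 < inner_coord (v i) g \<Longrightarrow>
       dist (T g (x i)) (T g (y i)) \<le> e"
proof -
  let ?D = "card B"
  define N where "N k = {v. L2_set v B = 1 \<and> (\<exists>x y. supported_pair (real (Suc k)) v x y)}" for k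
  define Q where "Q k c v \<longleftrightarrow> (\<forall>i\<le>?D. 0 \<le> c i \<and> v i \<in> N k) \<and> (\<Sum>i\<le>?D. c i) = 1 \<and>
    (\<forall>b\<in>B. \<bar>\<Sum>i\<le>?D. c i * v i b\<bar> \<le> 1 / real (Suc k))" for k c v
  have "\<exists>c v. Q k c v" for k
    unfolding Q_def
  proof (rule approximate_zero_convex_combination[OF finite_B])
    show "(\<Sum>b\<in>B. (v b)\<^sup>2) \<le> 1" if "v \<in> N k" for v
      using that unfolding N_def L2_set_square[symmetric] by simp
    show "\<exists>v\<in>N k. (\<Sum>b\<in>B. v b * w b) \<le> 1" for w
      using supported_pair_exists[OF assms, of "real (Suc k)" w] unfolding N_def by auto
  qed simp
  then obtain c v where cv: "\<And>k. Q k (c k) (v k)" by metis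
  have c: "0 \<le> c k i" "v k i \<in> N k" if "i \<le> ?D" for k i
    using cv[of k] that by (auto simp: Q_def)
  have csum: "(\<Sum>i\<le>?D. c k i) = 1" and csmall: "\<And>b. b \<in> B \<Longrightarrow> \<bar>\<Sum>i\<le>?D. c k i * v k i b\<bar> \<le> 1 / real (Suc k)" for k
    using cv[of k] by (auto simp: Q_def)
  have v1: "L2_set (v k i) B = 1" if "i \<le> ?D" for k i using c(2)[OF that] by (simp add: N_def)
  have "\<forall>k i. \<exists>q. i \<le> ?D \<longrightarrow> supported_pair (real (Suc k)) (v k i) (fst q) (snd q)"
    using c(2) by (fastforce simp: N_def)
  then obtain q where q: "\<And>k i. i \<le> ?D \<Longrightarrow> supported_pair (real (Suc k)) (v k i) (fst (q k i)) (snd (q k i))"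
    by metis
  have c_le: "c k i \<le> 1" if "i \<le> ?D" for k i
    using member_le_sum[of i "{..?D}" "c k"] c(1) csum[of k] that by simp
  have v_le: "\<bar>v k i b\<bar> \<le> 1" if "i \<le> ?D" "b \<in> B" for k i b
  proof -
    have "(v k i b)\<^sup>2 \<le> (L2_set (v k i) B)\<^sup>2"
      unfolding L2_set_square using finite_B that
      by (intro member_le_sum[of b B "\<lambda>b. (v k i b)\<^sup>2"]) auto
    then show ?thesis using v1[OF that(1)] by (simp add: abs_square_le_1)
  qed
  define f where "f j k = (case j of Inl i \<Rightarrow> c k i | Inr (i, b) \<Rightarrow> v k i b)" for j k
  have "\<exists>r l. strict_mono (r :: nat \<Rightarrow> nat) \<and>
      (\<forall>j\<in>{..?D} <+> {..?D} \<times> B. l j \<in> {-1..1} \<and> (f j \<circ> r) \<longlonglongrightarrow> l j)"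
  proof (rule compact_common_subsequence)
    show "finite ({..?D} <+> {..?D} \<times> B)" using finite_B by simp
    show "f j k \<in> {-1..1}" if j: "j \<in> {..?D} <+> {..?D} \<times> B" for j k
    proof (cases j)
      case (Inl i)
      then have "i \<le> ?D" using j by auto
      then show ?thesis using Inl c(1)[of i k] c_le[of i k] by (simp add: f_def)
    next
      case (Inr t)
      then obtain i b where t: "t = (i, b)" "i \<le> ?D" "b \<in> B" using j by auto
      then show ?thesis using Inr v_le[of i b k] by (simp add: f_def abs_le_iff)
    qed
  qed simp
  then obtain r l where r: "strict_mono r"
    "\<And>j. j \<in> {..?D} <+> {..?D} \<times> B \<Longrightarrow> (f j \<circ> r) \<longlonglongrightarrow> l j" by blast
  have "\<exists>s l. strict_mono (s :: nat \<Rightarrow> nat) \<and>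
      (\<forall>i\<in>{..?D}. l i \<in> X \<times> X \<and> ((\<lambda>k. q (r k) i) \<circ> s) \<longlonglongrightarrow> l i)"
  proof (rule compact_common_subsequence)
    show "q (r k) i \<in> X \<times> X" if "i \<in> {..?D}" for i k
      using q[of i "r k"] that by (auto simp: supported_pair_def mem_Times_iff)
  qed (simp_all add: compact_Times compact_space)
  then obtain s l' where s: "strict_mono s"
    "\<And>i. i \<le> ?D \<Longrightarrow> l' i \<in> X \<times> X" "\<And>i. i \<le> ?D \<Longrightarrow> ((\<lambda>k. q (r k) i) \<circ> s) \<longlonglongrightarrow> l' i" by auto
  define \<rho> where "\<rho> = r \<circ> s"
  have \<rho>: "strict_mono \<rho>" unfolding \<rho>_def using r(1) s(1) by (rule strict_mono_o)
  define c' where "c' i = l (Inl i)" for i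
  define v' where "v' i b = l (Inr (i, b))" for i b
  have clim: "(\<lambda>k. c (\<rho> k) i) \<longlonglongrightarrow> c' i" if "i \<le> ?D" for i
  proof -
    have "Inl i \<in> {..?D} <+> {..?D} \<times> B" using that by auto
    from LIMSEQ_subseq_LIMSEQ[OF r(2)[OF this] s(1)] show ?thesis
      by (simp add: f_def comp_def \<rho>_def c'_def)
  qed
  have vlim: "(\<lambda>k. v (\<rho> k) i b) \<longlonglongrightarrow> v' i b" if "i \<le> ?D" "b \<in> B" for i b
  proof -
    have "Inr (i, b) \<in> {..?D} <+> {..?D} \<times> B" using that by auto
    from LIMSEQ_subseq_LIMSEQ[OF r(2)[OF this] s(1)] show ?thesis
      by (simp add: f_def comp_def \<rho>_def v'_def)
  qed
  have qlim: "(\<lambda>k. fst (q (\<rho> k) i)) \<longlonglongrightarrow> fst (l' i)" "(\<lambda>k. snd (q (\<rho> k) i)) \<longlonglongrightarrow> snd (l' i)"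
    if "i \<le> ?D" for i
    using tendsto_fst[OF s(3)[OF that]] tendsto_snd[OF s(3)[OF that]] by (simp_all add: comp_def \<rho>_def)
  have qX: "fst (q k i) \<in> X" "snd (q k i) \<in> X" "fst (l' i) \<in> X" "snd (l' i) \<in> X" if "i \<le> ?D" for k i
    using q[OF that, of k] s(2)[OF that] by (auto simp: supported_pair_def)
  have inv0: "(\<lambda>k. C / real (Suc (\<rho> k))) \<longlonglongrightarrow> 0" for C :: real
    using LIMSEQ_subseq_LIMSEQ[OF tendsto_mult_right_zero[OF LIMSEQ_inverse_real_of_nat, of C] \<rho>]
    by (simp add: comp_def divide_inverse)
  show ?thesis
  proof (rule that[of c' v' "\<lambda>i. fst (l' i)" "\<lambda>i. snd (l' i)"])
    show "0 \<le> c' i" if "i \<le> ?D" for i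
      using c(1)[OF that] by (intro LIMSEQ_le_const[OF clim[OF that]]) auto
    have "(\<lambda>k. \<Sum>i\<le>?D. c (\<rho> k) i) \<longlonglongrightarrow> (\<Sum>i\<le>?D. c' i)"
      using clim by (intro tendsto_sum) auto
    then show "(\<Sum>i\<le>?D. c' i) = 1" using LIMSEQ_unique by (simp add: csum LIMSEQ_const_iff)
    show "(\<Sum>i\<le>?D. c' i * v' i b) = 0" if b: "b \<in> B" for b
    proof (rule LIMSEQ_unique)
      show "(\<lambda>k. \<Sum>i\<le>?D. c (\<rho> k) i * v (\<rho> k) i b) \<longlonglongrightarrow> (\<Sum>i\<le>?D. c' i * v' i b)"
        using clim vlim b by (intro tendsto_sum tendsto_mult) auto
      show "(\<lambda>k. \<Sum>i\<le>?D. c (\<rho> k) i * v (\<rho> k) i b) \<longlonglongrightarrow> 0"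
        using csmall[OF b] by (intro Lim_null_comparison[OF _ inv0[of 1]] always_eventually allI) simp
    qed
    show "L2_set (v' i) B = 1" if i: "i \<le> ?D" for i
    proof -
      have "(\<lambda>k. \<Sum>b\<in>B. (v (\<rho> k) i b)\<^sup>2) \<longlonglongrightarrow> (\<Sum>b\<in>B. (v' i b)\<^sup>2)"
        using vlim[OF i] by (intro tendsto_sum tendsto_power) auto
      then have "(L2_set (v' i) B)\<^sup>2 = 1"
        unfolding L2_set_square[symmetric] using v1[OF i] by (simp add: LIMSEQ_const_iff)
      then show ?thesis using L2_set_nonneg[of "v' i" B] by (simp add: power2_eq_1_iff)
    qed
    show "fst (l' i) \<in> X" "snd (l' i) \<in> X" if "i \<le> ?D" for i using qX[OF that] by auto
    show "fst (l' i) \<noteq> snd (l' i)" if i: "i \<le> ?D" for i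
    proof -
      have "e \<le> dist (fst (q (\<rho> k) i)) (snd (q (\<rho> k) i))" for k
        using q[OF i, of "\<rho> k"] by (simp add: supported_pair_def)
      then have "e \<le> dist (fst (l' i)) (snd (l' i))"
        by (intro LIMSEQ_le_const[OF tendsto_dist[OF qlim[OF i]]]) auto
      then show ?thesis using e by auto
    qed
    show "dist (T g (fst (l' i))) (T g (snd (l' i))) \<le> e"
      if i: "i \<le> ?D" and g: "g \<in> carrier G" and pos: "0 < inner_coord (v' i) g" for i g
    proof (rule tendsto_upperbound)
      show "(\<lambda>k. dist (T g (fst (q (\<rho> k) i))) (T g (snd (q (\<rho> k) i))))
          \<longlonglongrightarrow> dist (T g (fst (l' i))) (T g (snd (l' i)))"
        using qlim[OF i] qX[OF i] g by (intro tendsto_dist T_tendsto) auto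
      \<comment> \<open>For fixed \<open>g\<close> the term divided by the radius vanishes, so the
        supporting balls fill the open half-space in the limit.\<close>
      have "(\<lambda>k. 2 * inner_coord (v (\<rho> k) i) g - ((L2_set (coord g) B)\<^sup>2 + 1) / real (Suc (\<rho> k)))
          \<longlonglongrightarrow> 2 * inner_coord (v' i) g - 0"
        unfolding inner_coord_def
        by (intro tendsto_diff inv0 tendsto_mult tendsto_const tendsto_sum vlim[OF i])
      from order_tendstoD(1)[OF this, of 0] have "\<forall>\<^sub>F k in sequentially.
          0 < 2 * inner_coord (v (\<rho> k) i) g - ((L2_set (coord g) B)\<^sup>2 + 1) / real (Suc (\<rho> k))"
        using pos by simp
      then show "\<forall>\<^sub>F k in sequentially.
          dist (T g (fst (q (\<rho> k) i))) (T g (snd (q (\<rho> k) i))) \<le> e"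
      proof (rule eventually_mono)
        fix k
        assume "0 < 2 * inner_coord (v (\<rho> k) i) g - ((L2_set (coord g) B)\<^sup>2 + 1) / real (Suc (\<rho> k))"
        then show "dist (T g (fst (q (\<rho> k) i))) (T g (snd (q (\<rho> k) i))) \<le> e"
          using q[OF i, of "\<rho> k"] g unfolding supported_pair_def by simp
      qed
    qed simp
  qed
qed

text \<open>At a time \<open>g\<close> when all pairs of positive weight are apart, each of their
  normals has negative inner product with \<open>g\<close>, while the weighted sum of these inner
  products is zero.\<close>

lemma too_few_self_joinings:
  assumes "B \<noteq> {}" "card B + 1 < m"
  shows "n < 2 * (card B + 1)"
proof (rule ccontr)
  assume "\<not> ?thesis"
  then have n: "2 * (card B + 1) \<le> n" by simp
  let ?D = "card B"
  show False
  proof (rule close_on_balancing_half_spaces[OF assms(1)])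
    fix c :: "nat \<Rightarrow> real" and v :: "nat \<Rightarrow> 'd \<Rightarrow> real" and x y :: "nat \<Rightarrow> 'x"
    assume c: "\<And>i. i \<le> ?D \<Longrightarrow> 0 \<le> c i" "(\<Sum>i\<le>?D. c i) = 1"
      "\<And>b. b \<in> B \<Longrightarrow> (\<Sum>i\<le>?D. c i * v i b) = 0"
      and v: "\<And>i. i \<le> ?D \<Longrightarrow> L2_set (v i) B = 1"
      and X: "\<And>i. i \<le> ?D \<Longrightarrow> x i \<in> X" "\<And>i. i \<le> ?D \<Longrightarrow> y i \<in> X"
      and ne: "\<And>i. i \<le> ?D \<Longrightarrow> x i \<noteq> y i"
      and close: "\<And>i g. i \<le> ?D \<Longrightarrow> g \<in> carrier G \<Longrightarrow> 0 < inner_coord (v i) g \<Longrightarrow>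
         dist (T g (x i)) (T g (y i)) \<le> e"
    define I where "I = {i. i \<le> ?D \<and> 0 < c i}"
    have I: "finite I" "\<And>i. i \<in> I \<Longrightarrow> i \<le> ?D" by (auto simp: I_def)
    have "I \<noteq> {}"
    proof
      assume "I = {}"
      then have "(\<Sum>i\<le>?D. c i) = 0" using c(1) by (intro sum.neutral) (force simp: I_def)
      then show False using c(2) by simp
    qed
    have "card I \<le> card {..?D}" using I by (intro card_mono) auto
    then have cardI: "card I < m" "2 * card I \<le> n" using assms(2) n by auto
    \<comment> \<open>Shifting pair \<open>i\<close> by an element \<open>w i\<close> of its open
      half-space makes the boundary times good as well, so a pair that is apart forces a strict
      sign.\<close>
    have "\<forall>i. \<exists>g. i \<le> ?D \<longrightarrow> g \<in> carrier G \<and> 0 < inner_coord (v i) g"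
      using inner_coord_unbounded[OF v] by blast
    then obtain w where w: "\<And>i. i \<le> ?D \<Longrightarrow> w i \<in> carrier G"
      "\<And>i. i \<le> ?D \<Longrightarrow> 0 < inner_coord (v i) (w i)" by metis
    have close': "dist (T g (T (w i) (x i))) (T g (T (w i) (y i))) \<le> e"
      if i: "i \<le> ?D" and g: "g \<in> carrier G" "0 \<le> inner_coord (v i) g" for i g
      using close[OF i, of "g \<otimes> w i"] w[OF i] g X[OF i] by (simp add: inner_coord_mult act_mult)
    have orb: "T (w i) (y i) \<noteq> T g (T (w i) (x i))" if i: "i \<le> ?D" and g: "g \<in> carrier G" for i g
    proof (rule thick_imp_different_orbits[OF thick_half_space[OF v[OF i]] _ _ _ _ g])
      show "T (w i) (x i) \<noteq> T (w i) (y i)"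
        using ne[OF i] T_inv[OF w(1)[OF i] X(1)[OF i]] T_inv[OF w(1)[OF i] X(2)[OF i]] by metis
      show "dist (T g (T (w i) (x i))) (T g (T (w i) (y i))) \<le> e"
        if "g \<in> {g \<in> carrier G. 0 < inner_coord (v i) g}" for g
        using that by (intro close'[OF i]) auto
    qed (use X[OF i] w(1)[OF i] in simp_all)
    obtain g where g: "g \<in> carrier G" "\<And>i. i \<in> I \<Longrightarrow> e < dist (T g (T (w i) (x i))) (T g (T (w i) (y i)))"
      using no_close_cover[OF I(1) \<open>I \<noteq> {}\<close> cardI, of "\<lambda>i. T (w i) (x i)" "\<lambda>i. T (w i) (y i)"]
        I(2) w(1) X orb by auto
    have neg: "inner_coord (v i) g < 0" if "i \<in> I" for i
      using close'[OF I(2)[OF that] g(1)] g(2)[OF that] by force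
    have "(\<Sum>i\<le>?D. c i * inner_coord (v i) g) = (\<Sum>b\<in>B. (\<Sum>i\<le>?D. c i * v i b) * coord g b)"
      unfolding inner_coord_def sum_distrib_left sum_distrib_right
      by (subst sum.swap) (simp add: mult.assoc)
    also have "\<dots> = 0" using c(3) by simp
    finally have "(\<Sum>i\<le>?D. - (c i * inner_coord (v i) g)) = 0" by (simp add: sum_negf)
    moreover have "0 \<le> - (c i * inner_coord (v i) g)" if "i \<in> {..?D}" for i
    proof (cases "i \<in> I")
      case True
      then show ?thesis using neg[OF True] by (simp add: I_def mult_le_0_iff)
    next
      case False
      then have "c i = 0" using that c(1)[of i] by (simp add: I_def)
      then show ?thesis by simp
    qed
    ultimately have zero: "- (c i * inner_coord (v i) g) = 0" if "i \<le> ?D" for i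
      using that sum_nonneg_eq_0_iff[of "{..?D}" "\<lambda>i. - (c i * inner_coord (v i) g)"] by simp
    obtain i where i: "i \<in> I" using \<open>I \<noteq> {}\<close> by blast
    then show False using zero[OF I(2)[OF i]] neg[OF i] by (simp add: I_def)
  qed
qed

end

theorem theorem4:
  fixes G :: "('g, 'm) monoid_scheme" and d :: nat
  assumes "comm_group G"
    and "finitely_generated G"
    and "d = group_rank G"
  shows "\<not> (\<exists>(X :: 'x::metric_space set) T.
             topological_dynamical_system G X T \<and> strong_TMSJ (2 * (d + 1)) G X T)"
proof
  assume "\<exists>(X :: 'x set) T. topological_dynamical_system G X T \<and> strong_TMSJ (2 * (d + 1)) G X T"
  then obtain X :: "'x set" and T where tds: "topological_dynamical_system G X T"
    and sTMSJ: "strong_TMSJ (2 * (d + 1)) G X T" by blast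
  interpret G: comm_group G by fact
  obtain S where S: "finite S" "S \<subseteq> carrier G" "generate G S = carrier G"
    using assms(2) unfolding finitely_generated_def by blast
  show False
  proof (rule G.lattice_coordinates[OF S])
    fix B and p :: "'g \<Rightarrow> 'g \<Rightarrow> int" and M
    assume B: "finite B" "B \<subseteq> carrier G" and M: "M > 0"
      and hom: "\<And>g h b. g \<in> carrier G \<Longrightarrow> h \<in> carrier G \<Longrightarrow> p (g \<otimes>\<^bsub>G\<^esub> h) b = p g b + p h b"
      and dual: "\<And>b b'. b \<in> B \<Longrightarrow> b' \<in> B \<Longrightarrow> p b b' = (if b = b' then M else 0)"
      and surj: "\<And>f. \<exists>g\<in>carrier G. \<forall>b\<in>B. p g b = M * f b"
      and boxes: "\<And>R. finite {g \<in> carrier G. \<forall>b\<in>B. \<bar>p g b\<bar> \<le> R}"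
    have rank: "card B \<le> d"
      unfolding assms(3) by (rule G.card_le_group_rank[OF S B hom dual M])
    have "carrier G \<subseteq> (\<Union>k::nat. {g \<in> carrier G. \<forall>b\<in>B. \<bar>p g b\<bar> \<le> int k})"
    proof
      fix g assume g: "g \<in> carrier G"
      have "\<bar>p g b\<bar> \<le> int (nat (\<Sum>b\<in>B. \<bar>p g b\<bar>))" if "b \<in> B" for b
        using member_le_sum[OF that, of "\<lambda>b. \<bar>p g b\<bar>"] B(1) by (simp add: sum_nonneg)
      then show "g \<in> (\<Union>k::nat. {g \<in> carrier G. \<forall>b\<in>B. \<bar>p g b\<bar> \<le> int k})" using g by blast
    qed
    moreover have "countable (\<Union>k::nat. {g \<in> carrier G. \<forall>b\<in>B. \<bar>p g b\<bar> \<le> int k})"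
      by (rule countable_UN) (simp_all add: boxes countable_finite)
    ultimately have "countable (carrier G)" by (rule countable_subset)
    then interpret self_joining_system G X T "2 * (d + 1)"
      using tds sTMSJ assms(1)
      by (intro self_joining_system.intro self_joining_system_axioms.intro) simp_all
    have "B \<noteq> {}"
    proof
      assume "B = {}"
      then have "finite (carrier G)" using boxes[of 0] by simp
      moreover obtain x where "x \<in> X" using infinite_space by (metis finite.emptyI all_not_in_conv)
      ultimately show False using infinite_orbit by blast
    qed
    \<comment> \<open>With \<open>card B \<le> d\<close>, the number \<open>d + 2\<close> exceeds
      \<open>card B + 1\<close>, the largest number of pairs to be separated.\<close>
    obtain a \<delta> where a: "0 < \<delta>" "\<forall>i<d + 2. a i \<in> carrier G"
      "\<forall>i<d + 2. \<forall>j<d + 2. i \<noteq> j \<longrightarrow> (\<forall>y\<in>X. \<delta> \<le> dist (T (a i) y) (T (a j) y))"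
      using separated_translations[of "d + 2"] by blast
    obtain e0 where e0: "0 < e0"
      "\<forall>h\<in>carrier G. (\<forall>z\<in>X. dist z (T h z) \<le> e0) \<longrightarrow> (\<forall>z\<in>X. T h z = z)"
      using small_displacement_trivial by blast
    \<comment> \<open>One scale for both purposes: \<open>e0\<close> gives rigidity, and a third of
      \<open>\<delta>\<close> gives \<open>2 * e < \<delta>\<close>.\<close>
    define e where "e = min e0 (\<delta> / 3)"
    have e: "e > 0" "e \<le> e0" "2 * e < \<delta>" using e0(1) a(1) by (auto simp: e_def)
    interpret lattice_system G X T "2 * (d + 1)" e a "d + 2" B p M
    proof unfold_locales
      show "T h z = z" if "h \<in> carrier G" "\<And>z. z \<in> X \<Longrightarrow> dist z (T h z) \<le> e" "z \<in> X" for h z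
        by (rule e0(2)[rule_format, OF that(1) order_trans[OF that(2) e(2)] that(3)])
      show "2 * e < dist (T (a i) y) (T (a j) y)" if "i < d + 2" "j < d + 2" "i \<noteq> j" "y \<in> X" for i j y
        using a(3)[rule_format, OF that] e(3) by simp
    qed (use e a(2) B(1) hom M surj boxes in auto)
    show False using too_few_self_joinings[OF \<open>B \<noteq> {}\<close>] rank by simp
  qed
qed

end
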